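(* Consider the semi-static hedging problem $$(SSH)\qquad\text{minimize } EV\Big(c-\sum_{t=0}^{T-1}x_t\cdot\Delta s_{t+1}-\bar c\cdot\bar x+S_0(\bar x)\Big)\ \text{ over adapted } x=(x_t)_{t=0}^{T-1},\ \bar x\in\mathbb R^{\bar J},\ \text{ subject to } x_t\in D_t,\ t=0,\dots,T-1\ \text{a.s.}$$ and the dual problem $$(D_{SSH})\qquad\text{maximize } E\Big[cy-V^*(y)-\sum_{t=0}^{T-1}\sigma_{D_t}(p_t+y\Delta s_{t+1})-(yS_0)^*(p_{-1}+y\bar c)\Big]\ \text{ over } p\in\mathcal X_a^\perp,\ y\in\mathcal Y.$$ If $(SSH)$ and $(D_{SSH})$ are feasible, then the following are equivalent: 1. $(\bar x,x)$ solves $(SSH)$, $(p,y)$ solves $(D_{SSH})$ and there is no duality gap (i.e. $\inf(SSH)=\sup(D_{SSH})$); 2. $(\bar x,x)$ is feasible in $(SSH)$, $(p,y)$ is feasible in $(D_{SSH})$ and, almost surely, $$y\in\partial V\Big(c-\sum_{t=0}^{T-1}x_t\cdot\Delta s_{t+1}-\bar c\cdot\bar x+S_0(\bar x)\Big),$$ $$p_t+y\Delta s_{t+1}\in N_{D_t}(x_t),\quad t=0,\dots,T-1,$$ $$p_{-1}+y\bar c\in\partial(yS_0)(\bar x).$$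
   Context: $(\Omega,\mathcal F,P)$ is a probability space with a filtration $(\mathcal F_t)_{t=0}^T$ and $\mathcal F_{-1}:=\{\Omega,\emptyset\}$. Random variables equal a.s. are identified. The expectation of an extended real-valued random variable is $+\infty$ unless its positive part is integrable; the dual objective is read as $E[cy]-E[V^*(y)+\sum_{t}\sigma_{D_t}(\cdot)+(yS_0)^*(\cdot)]$. $J,\bar J$ are finite sets; $s=(s_t)_{t=0}^T$ is an adapted $\mathbb R^J$-valued process, $\Delta s_{t+1}:=s_{t+1}-s_t$; $\bar c=(\bar c^j)_{j\in\bar J}$ with $\bar c^j\in L^0$; $S_0:\mathbb R^{\bar J}\to\mathbb R$ is a finite convex function with $S_0(0)=0$. $D_t$ is an $\mathcal F_t$-measurable random closed convex subset of $\mathbb R^J$ with $0\in D_t$ a.s. $V$ is a loss function: a convex normal integrand on $\mathbb R\times\Omega$ (possibly deterministic) with $V(\cdot,\omega)$ closed convex, nondecreasing and nonconstant; $V^*$ is its ($\omega$-wise) conjugate. $\sigma_D(v):=\sup_{x\in D}x\cdot v$, $N_D(x)$ is the normal cone of $D$ at $x$ (empty if $x\notin D$), $(yS_0)^*(v):=\sup_{\bar x}\{\bar x\cdot v-yS_0(\bar x)\}$; subdifferentials are $\omega$-wise. The strategy $(\bar x,x)$ is identified with $(x_{-1},x_0,\dots,x_{T-1})$, $x_{-1}=\bar x$ ($\mathcal F_{-1}$-measurable, i.e. constant), and $\mathcal N$ denotes the space of all such processes in $L^0$ with $x_t$ $\mathcal F_t$-measurable, $t=-1,\dots,T-1$ ($x_{-1}\in\mathbb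 R^{\bar J}$, $x_t\in\mathbb R^J$ for $t\ge0$). A linear space of $\mathbb R^k$-valued random variables is decomposable if it contains $1_Au+1_{\Omega\setminus A}u'$ for all its elements $u$, all $u'\in L^\infty$, $A\in\mathcal F$; it is solid if it contains every $u\in L^0$ with $|u^i|\le|\bar u^i|$ a.s. for all $i$ for some element $\bar u$. $\mathcal X,\mathcal V$ are solid decomposable spaces of random variables with values in $\mathbb R^{\bar J}\times(\mathbb R^J)^T$ in separating duality under $\langle x,v\rangle:=E[x\cdot v]$; $\mathcal U,\mathcal Y$ are solid decomposable spaces of real-valued random variables in separating duality under $\langle u,y\rangle:=E[uy]$. $c\in\mathcal U$, and $EV$ is proper on $\mathcal U$. $\mathcal X_a:=\mathcal X\cap\mathcal N$, $\mathcal X_a^\perp:=\{v\in\mathcal V:\langle x,v\rangle=0\ \forall x\in\mathcal X_a\}$, with elements $p=(p_{-1},p_0,\dots,p_{T-1})$. Feasible in $(SSH)$: $(\bar x,x)\in\mathcal N$ satisfying the constraints with objective value $<\infty$. Feasible in $(D_{SSH})$: $(p,y)\in\mathcal X_a^\perp\times\mathcal Y$ with objective value $>-\infty$. A problem is feasible if it has a feasible point; "solves" means feasible and attaining the optimum value. *)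

theory Defs
  imports "HOL-Probability.Probability"
begin

section \<open>Expectation of extended real-valued random variables\<close>

text \<open>The map \<^const>\<open>e2ennreal\<close> sends negative numbers to 0, so the two integrals are those of the
  positive and of the negative part.\<close>

definition ext_expectation :: "'a measure \<Rightarrow> ('a \<Rightarrow> ereal) \<Rightarrow> ereal" where
  "ext_expectation M X =
     (if (\<integral>\<^sup>+\<omega>. e2ennreal (X \<omega>) \<partial>M) = \<infinity> then \<infinity>
      else enn2ereal (\<integral>\<^sup>+\<omega>. e2ennreal (X \<omega>) \<partial>M) - enn2ereal (\<integral>\<^sup>+\<omega>. e2ennreal (- X \<omega>) \<partial>M))"


section \<open>Convex analysis\<close>

text \<open>A finite index set is a subset \<open>J\<close> of a finite type, and the space of real vectors indexed
  by \<open>J\<close> is the following subspace. Index types being nonempty, this is what allows \<open>J\<close> to be empty;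
  \<open>J = UNIV\<close> gives the whole space. Conjugates, subdifferentials and normal cones are taken in
  this subspace.\<close>

definition coord_space :: "'j::finite set \<Rightarrow> (real ^ 'j) set" where
  "coord_space J = {x. \<forall>j. j \<notin> J \<longrightarrow> x $ j = 0}"

definition conjugate_on :: "'b::real_inner set \<Rightarrow> ('b \<Rightarrow> ereal) \<Rightarrow> 'b \<Rightarrow> ereal" where
  "conjugate_on E f v = (SUP x\<in>E. ereal (x \<bullet> v) - f x)"

definition subdifferential_on :: "'b::real_inner set \<Rightarrow> ('b \<Rightarrow> ereal) \<Rightarrow> 'b \<Rightarrow> 'b set" where
  "subdifferential_on E f x = {v \<in> E. \<forall>x'\<in>E. f x + ereal (v \<bullet> (x' - x)) \<le> f x'}"

definition support_fun :: "'b::real_inner set \<Rightarrow> 'b \<Rightarrow> ereal" where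
  "support_fun D v = (SUP x\<in>D. ereal (x \<bullet> v))"

definition normal_cone_on :: "'b::real_inner set \<Rightarrow> 'b set \<Rightarrow> 'b \<Rightarrow> 'b set" where
  "normal_cone_on E D x = (if x \<in> D then {v \<in> E. \<forall>x'\<in>D. v \<bullet> (x' - x) \<le> 0} else {})"


section \<open>Random sets and integrands\<close>

definition measurable_set_valued :: "'a measure \<Rightarrow> ('a \<Rightarrow> 'b::topological_space set) \<Rightarrow> bool" where
  "measurable_set_valued N D \<longleftrightarrow> (\<forall>G. open G \<longrightarrow> {\<omega> \<in> space N. D \<omega> \<inter> G \<noteq> {}} \<in> sets N)"

definition random_closed_convex_set ::
    "'a measure \<Rightarrow> 'b::{real_vector, topological_space} set \<Rightarrow> ('a \<Rightarrow> 'b set) \<Rightarrow> bool" where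
  "random_closed_convex_set N E D \<longleftrightarrow>
     measurable_set_valued N D \<and> (\<forall>\<omega>\<in>space N. closed (D \<omega>) \<and> convex (D \<omega>) \<and> D \<omega> \<subseteq> E)"

definition ereal_epigraph :: "('b \<Rightarrow> ereal) \<Rightarrow> ('b \<times> real) set" where
  "ereal_epigraph f = {(x, \<alpha>). f x \<le> ereal \<alpha>}"

definition convex_normal_integrand ::
    "'a measure \<Rightarrow> ('a \<Rightarrow> 'b::{real_vector, topological_space} \<Rightarrow> ereal) \<Rightarrow> bool" where
  "convex_normal_integrand M f \<longleftrightarrow> random_closed_convex_set M UNIV (\<lambda>\<omega>. ereal_epigraph (f \<omega>))"

text \<open>Closedness and convexity of each \<open>V \<omega>\<close> are those of its epigraph, which are part of
  \<^const>\<open>convex_normal_integrand\<close>.\<close>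

definition loss_function :: "'a measure \<Rightarrow> ('a \<Rightarrow> real \<Rightarrow> ereal) \<Rightarrow> bool" where
  "loss_function M V \<longleftrightarrow>
     convex_normal_integrand M V \<and>
     (\<forall>\<omega>\<in>space M. mono (V \<omega>) \<and> \<not> (\<exists>k. \<forall>u. V \<omega> u = k))"

definition EV_proper_on :: "'a measure \<Rightarrow> ('a \<Rightarrow> real \<Rightarrow> ereal) \<Rightarrow> ('a \<Rightarrow> real) set \<Rightarrow> bool" where
  "EV_proper_on M V U \<longleftrightarrow>
     (\<forall>u\<in>U. ext_expectation M (\<lambda>\<omega>. V \<omega> (u \<omega>)) > - \<infinity>) \<and>
     (\<exists>u\<in>U. ext_expectation M (\<lambda>\<omega>. V \<omega> (u \<omega>)) < \<infinity>)"


section \<open>Spaces of random vectors\<close>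

text \<open>A random vector with components indexed by \<open>I\<close> is a function of type \<open>'a \<Rightarrow> 'i \<Rightarrow> real\<close> that
  vanishes at indices outside \<open>I\<close>. Almost surely equal random vectors are not made equal; solid
  spaces are closed under modification on null sets.\<close>

definition L0 :: "'a measure \<Rightarrow> 'i set \<Rightarrow> ('a \<Rightarrow> 'i \<Rightarrow> real) set" where
  "L0 M I = {u. (\<forall>i\<in>I. (\<lambda>\<omega>. u \<omega> i) \<in> borel_measurable M) \<and>
                (\<forall>\<omega>\<in>space M. \<forall>i. i \<notin> I \<longrightarrow> u \<omega> i = 0)}"

definition L_infty :: "'a measure \<Rightarrow> 'i set \<Rightarrow> ('a \<Rightarrow> 'i \<Rightarrow> real) set" where
  "L_infty M I = {u \<in> L0 M I. \<exists>C. AE \<omega> in M. \<forall>i\<in>I. \<bar>u \<omega> i\<bar> \<le> C}"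

definition linear_space_rv :: "'a measure \<Rightarrow> 'i set \<Rightarrow> ('a \<Rightarrow> 'i \<Rightarrow> real) set \<Rightarrow> bool" where
  "linear_space_rv M I L \<longleftrightarrow>
     L \<subseteq> L0 M I \<and> (\<lambda>\<omega> i. 0) \<in> L \<and>
     (\<forall>u\<in>L. \<forall>u'\<in>L. (\<lambda>\<omega> i. u \<omega> i + u' \<omega> i) \<in> L) \<and>
     (\<forall>a. \<forall>u\<in>L. (\<lambda>\<omega> i. a * u \<omega> i) \<in> L)"

definition decomposable :: "'a measure \<Rightarrow> 'i set \<Rightarrow> ('a \<Rightarrow> 'i \<Rightarrow> real) set \<Rightarrow> bool" where
  "decomposable M I L \<longleftrightarrow>
     (\<forall>u\<in>L. \<forall>u'\<in>L_infty M I. \<forall>A\<in>sets M. (\<lambda>\<omega>. if \<omega> \<in> A then u \<omega> else u' \<omega>) \<in> L)"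

definition solid :: "'a measure \<Rightarrow> 'i set \<Rightarrow> ('a \<Rightarrow> 'i \<Rightarrow> real) set \<Rightarrow> bool" where
  "solid M I L \<longleftrightarrow>
     (\<forall>u\<in>L0 M I. (\<exists>u'\<in>L. AE \<omega> in M. \<forall>i\<in>I. \<bar>u \<omega> i\<bar> \<le> \<bar>u' \<omega> i\<bar>) \<longrightarrow> u \<in> L)"

definition pairing ::
    "'a measure \<Rightarrow> 'i set \<Rightarrow> ('a \<Rightarrow> 'i \<Rightarrow> real) \<Rightarrow> ('a \<Rightarrow> 'i \<Rightarrow> real) \<Rightarrow> real" where
  "pairing M I x v = (\<integral>\<omega>. (\<Sum>i\<in>I. x \<omega> i * v \<omega> i) \<partial>M)"

definition separating_duality ::
    "'a measure \<Rightarrow> 'i set \<Rightarrow> ('a \<Rightarrow> 'i \<Rightarrow> real) set \<Rightarrow> ('a \<Rightarrow> 'i \<Rightarrow> real) set \<Rightarrow> bool" where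
  "separating_duality M I L L' \<longleftrightarrow>
     (\<forall>x\<in>L. \<forall>v\<in>L'. integrable M (\<lambda>\<omega>. \<Sum>i\<in>I. x \<omega> i * v \<omega> i)) \<and>
     (\<forall>x\<in>L. (\<forall>v\<in>L'. pairing M I x v = 0) \<longrightarrow> (AE \<omega> in M. \<forall>i\<in>I. x \<omega> i = 0)) \<and>
     (\<forall>v\<in>L'. (\<forall>x\<in>L. pairing M I x v = 0) \<longrightarrow> (AE \<omega> in M. \<forall>i\<in>I. v \<omega> i = 0))"

definition dual_spaces ::
    "'a measure \<Rightarrow> 'i set \<Rightarrow> ('a \<Rightarrow> 'i \<Rightarrow> real) set \<Rightarrow> ('a \<Rightarrow> 'i \<Rightarrow> real) set \<Rightarrow> bool" where
  "dual_spaces M I L L' \<longleftrightarrow>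
     linear_space_rv M I L \<and> solid M I L \<and> decomposable M I L \<and>
     linear_space_rv M I L' \<and> solid M I L' \<and> decomposable M I L' \<and>
     separating_duality M I L L'"

definition scalar_rv :: "('a \<Rightarrow> real) \<Rightarrow> 'a \<Rightarrow> unit \<Rightarrow> real" where
  "scalar_rv u = (\<lambda>\<omega> _. u \<omega>)"


section \<open>Strategies\<close>

text \<open>The component \<open>Inl j\<close> is the coordinate \<open>j\<close> of the static part, at time \<open>-1\<close>; the component
  \<open>Inr (t, j)\<close> is the coordinate \<open>j\<close> of the dynamic part at time \<open>t < T\<close>.\<close>

definition strategy_index :: "nat \<Rightarrow> 'j set \<Rightarrow> 'jb set \<Rightarrow> ('jb + nat \<times> 'j) set" where
  "strategy_index T J Jb = Inl ` Jb \<union> Inr ` ({..<T} \<times> J)"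

definition static_part :: "('jb::finite + nat \<times> 'j \<Rightarrow> real) \<Rightarrow> real ^ 'jb" where
  "static_part v = (\<chi> j. v (Inl j))"

definition dynamic_part :: "('jb + nat \<times> 'j::finite \<Rightarrow> real) \<Rightarrow> nat \<Rightarrow> real ^ 'j" where
  "dynamic_part v t = (\<chi> j. v (Inr (t, j)))"

text \<open>The measure space \<open>sigma (space M) {}\<close> carries the trivial sigma-algebra, which is the
  information available at time \<open>-1\<close>.\<close>

definition adapted_strategies ::
    "'a measure \<Rightarrow> (nat \<Rightarrow> 'a measure) \<Rightarrow> nat \<Rightarrow> 'j::finite set \<Rightarrow> 'jb::finite set \<Rightarrow>
     ('a \<Rightarrow> 'jb + nat \<times> 'j \<Rightarrow> real) set" where
  "adapted_strategies M F T J Jb =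
     {x \<in> L0 M (strategy_index T J Jb).
        (\<lambda>\<omega>. static_part (x \<omega>)) \<in> borel_measurable (sigma (space M) {}) \<and>
        (\<forall>t<T. (\<lambda>\<omega>. dynamic_part (x \<omega>) t) \<in> borel_measurable (F t))}"

definition adapted_annihilator ::
    "'a measure \<Rightarrow> (nat \<Rightarrow> 'a measure) \<Rightarrow> nat \<Rightarrow> 'j::finite set \<Rightarrow> 'jb::finite set \<Rightarrow>
     ('a \<Rightarrow> 'jb + nat \<times> 'j \<Rightarrow> real) set \<Rightarrow> ('a \<Rightarrow> 'jb + nat \<times> 'j \<Rightarrow> real) set \<Rightarrow>
     ('a \<Rightarrow> 'jb + nat \<times> 'j \<Rightarrow> real) set" where
  "adapted_annihilator M F T J Jb XX VV =
     {v \<in> VV. \<forall>x \<in> XX \<inter> adapted_strategies M F T J Jb. pairing M (strategy_index T J Jb) x v = 0}"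


section \<open>The primal problem\<close>

definition net_liability ::
    "nat \<Rightarrow> (nat \<Rightarrow> 'a \<Rightarrow> real ^ 'j) \<Rightarrow> ('a \<Rightarrow> real ^ 'jb) \<Rightarrow> (real ^ 'jb \<Rightarrow> real) \<Rightarrow> ('a \<Rightarrow> real) \<Rightarrow>
     ('a \<Rightarrow> 'jb::finite + nat \<times> 'j::finite \<Rightarrow> real) \<Rightarrow> 'a \<Rightarrow> real" where
  "net_liability T s cb S0 c x \<omega> =
     c \<omega> - (\<Sum>t<T. dynamic_part (x \<omega>) t \<bullet> (s (Suc t) \<omega> - s t \<omega>))
         - cb \<omega> \<bullet> static_part (x \<omega>) + S0 (static_part (x \<omega>))"

definition SSH_objective ::
    "'a measure \<Rightarrow> nat \<Rightarrow> (nat \<Rightarrow> 'a \<Rightarrow> real ^ 'j) \<Rightarrow> ('a \<Rightarrow> real ^ 'jb) \<Rightarrow> (real ^ 'jb \<Rightarrow> real) \<Rightarrow>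
     ('a \<Rightarrow> real \<Rightarrow> ereal) \<Rightarrow> ('a \<Rightarrow> real) \<Rightarrow>
     ('a \<Rightarrow> 'jb::finite + nat \<times> 'j::finite \<Rightarrow> real) \<Rightarrow> ereal" where
  "SSH_objective M T s cb S0 V c x = ext_expectation M (\<lambda>\<omega>. V \<omega> (net_liability T s cb S0 c x \<omega>))"

definition SSH_constraint_set ::
    "'a measure \<Rightarrow> (nat \<Rightarrow> 'a measure) \<Rightarrow> nat \<Rightarrow> 'j::finite set \<Rightarrow> 'jb::finite set \<Rightarrow>
     (nat \<Rightarrow> 'a \<Rightarrow> (real ^ 'j) set) \<Rightarrow> ('a \<Rightarrow> 'jb + nat \<times> 'j \<Rightarrow> real) set" where
  "SSH_constraint_set M F T J Jb D =
     {x \<in> adapted_strategies M F T J Jb. \<forall>t<T. AE \<omega> in M. dynamic_part (x \<omega>) t \<in> D t \<omega>}"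

definition SSH_feasible where
  "SSH_feasible M F T J Jb s cb S0 D V c x \<longleftrightarrow>
     x \<in> SSH_constraint_set M F T J Jb D \<and> SSH_objective M T s cb S0 V c x < \<infinity>"

definition SSH_value where
  "SSH_value M F T J Jb s cb S0 D V c =
     (INF x \<in> SSH_constraint_set M F T J Jb D. SSH_objective M T s cb S0 V c x)"

definition SSH_solves where
  "SSH_solves M F T J Jb s cb S0 D V c x \<longleftrightarrow>
     SSH_feasible M F T J Jb s cb S0 D V c x \<and>
     SSH_objective M T s cb S0 V c x = SSH_value M F T J Jb s cb S0 D V c"


section \<open>The dual problem\<close>

definition DSSH_objective ::
    "'a measure \<Rightarrow> nat \<Rightarrow> 'jb set \<Rightarrow> (nat \<Rightarrow> 'a \<Rightarrow> real ^ 'j) \<Rightarrow> ('a \<Rightarrow> real ^ 'jb) \<Rightarrow>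
     (real ^ 'jb \<Rightarrow> real) \<Rightarrow> (nat \<Rightarrow> 'a \<Rightarrow> (real ^ 'j) set) \<Rightarrow> ('a \<Rightarrow> real \<Rightarrow> ereal) \<Rightarrow> ('a \<Rightarrow> real) \<Rightarrow>
     ('a \<Rightarrow> 'jb::finite + nat \<times> 'j::finite \<Rightarrow> real) \<Rightarrow> ('a \<Rightarrow> real) \<Rightarrow> ereal" where
  "DSSH_objective M T Jb s cb S0 D V c p y =
     ereal (\<integral>\<omega>. c \<omega> * y \<omega> \<partial>M) -
     ext_expectation M (\<lambda>\<omega>.
       conjugate_on UNIV (V \<omega>) (y \<omega>)
       + (\<Sum>t<T. support_fun (D t \<omega>) (dynamic_part (p \<omega>) t + y \<omega> *\<^sub>R (s (Suc t) \<omega> - s t \<omega>)))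
       + conjugate_on (coord_space Jb) (\<lambda>xb. ereal (y \<omega> * S0 xb))
           (static_part (p \<omega>) + y \<omega> *\<^sub>R cb \<omega>))"

definition DSSH_feasible where
  "DSSH_feasible M F T J Jb s cb S0 D V c XX VV Y p y \<longleftrightarrow>
     p \<in> adapted_annihilator M F T J Jb XX VV \<and> y \<in> Y \<and>
     DSSH_objective M T Jb s cb S0 D V c p y > - \<infinity>"

definition DSSH_value where
  "DSSH_value M F T J Jb s cb S0 D V c XX VV Y =
     (SUP (p, y) \<in> adapted_annihilator M F T J Jb XX VV \<times> Y.
        DSSH_objective M T Jb s cb S0 D V c p y)"

definition DSSH_solves where
  "DSSH_solves M F T J Jb s cb S0 D V c XX VV Y p y \<longleftrightarrow>
     DSSH_feasible M F T J Jb s cb S0 D V c XX VV Y p y \<and>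
     DSSH_objective M T Jb s cb S0 D V c p y = DSSH_value M F T J Jb s cb S0 D V c XX VV Y"

end

theory Submission
  imports Defs
begin

text \<open>For feasible \<open>x\<close> and \<open>(p, y)\<close> the pointwise Fenchel inequalities of \<open>V\<close>, of the sets \<open>D t\<close> and of
  \<open>y S0\<close> add up to \<open>V(w) + B \<ge> c y + x \<bullet> p\<close>, where \<open>w\<close> is the net liability and \<open>B\<close> the integrand
  subtracted in the dual objective; equality means equality in each of them, that is, the
  subdifferential conditions. Feasibility makes the positive parts of \<open>V(w)\<close> and \<open>B\<close> integrable, so
  \<open>x \<bullet> p\<close> is bounded above by an integrable function. Although \<open>x\<close> is an arbitrary adapted process,
  this one-sided bound forces \<open>x \<bullet> p\<close> to be integrable with mean zero. Hence the
  duality gap is the expectation of a nonnegative function, which vanishes almost surely if and only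
  if the gap is zero.\<close>

text \<open>The annihilator condition tests \<open>p\<close> only against adapted strategies in
  \<open>XX\<close>, whereas a feasible strategy may be any adapted process. Its single products
  \<open>x i * p i\<close> need not be integrable; only their sum is bounded from above, so its mean
  cannot be computed term by term. The way out is localization on sets known at the latest time
  involved, where all positions are bounded. There \<open>p\<close> need only be tested against
  indicators in one component, which decomposability puts into \<open>XX\<close>. The phenomenon is
  that of discrete-time local martingales started at 0, where an integrable negative part of the
  terminal value yields a true martingale. A second obstacle is that \<open>ext_expectation\<close>
  makes sense for every function but is well-behaved only for measurable ones; hence the
  measurability of conjugates and support functions at random arguments has to be derived from that
  of the random sets.\<close>

section \<open>Adapted processes and orthogonal integrands\<close>

text \<open>The sets belong to \<open>G\<close>, so that their indicators can later be pulled out of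
  conditional expectations given \<open>G\<close>. They exhaust the space because finitely many real
  values have a common bound.\<close>

lemma bounded_truncation:
  fixes x :: "'i \<Rightarrow> 'a \<Rightarrow> real"
  assumes "finite I" and x: "\<And>j. j \<in> I \<Longrightarrow> x j \<in> borel_measurable G"
  obtains A :: "nat \<Rightarrow> 'a set" where "\<And>n. A n \<in> sets G" and "incseq A" and "(\<Union>n. A n) = space G"
    and "\<And>n j \<omega>. j \<in> I \<Longrightarrow> \<omega> \<in> A n \<Longrightarrow> \<bar>x j \<omega>\<bar> \<le> real n"
proof
  let ?A = "\<lambda>n::nat. {\<omega> \<in> space G. \<forall>j\<in>I. \<bar>x j \<omega>\<bar> \<le> real n}"
  show "?A n \<in> sets G" for n
    using x by (intro sets.sets_Collect_finite_All \<open>finite I\<close>) simp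
  show "incseq ?A"
    unfolding incseq_def by force
  show "(\<Union>n. ?A n) = space G"
  proof safe
    fix \<omega> assume "\<omega> \<in> space G"
    obtain n :: nat where "(\<Sum>j\<in>I. \<bar>x j \<omega>\<bar>) \<le> real n"
      using real_arch_simple by blast
    then have "\<bar>x j \<omega>\<bar> \<le> real n" if "j \<in> I" for j
      using member_le_sum[OF that, of "\<lambda>j. \<bar>x j \<omega>\<bar>"] \<open>finite I\<close> by simp
    with \<open>\<omega> \<in> space G\<close> show "\<omega> \<in> (\<Union>n. ?A n)" by blast
  qed
qed auto

text \<open>Induction on the number of indices, removing one of latest information. On the sets where all
  \<open>x j\<close> are bounded, conditioning on that information kills its term and replaces the remaining
  \<open>p j\<close> by conditional expectations; monotone convergence along \<open>\<phi> - S \<ge> 0\<close> then recovers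
  the integrability of the full sum.\<close>

lemma adapted_orthogonal_integral_zero:
  fixes x p :: "'i \<Rightarrow> 'a \<Rightarrow> real" and rank :: "'i \<Rightarrow> nat"
  assumes "prob_space M" and "finite I"
    and "\<And>i. i \<in> I \<Longrightarrow> subalgebra M (G i)"
    and "\<And>i j. i \<in> I \<Longrightarrow> j \<in> I \<Longrightarrow> rank i \<le> rank j \<Longrightarrow> subalgebra (G j) (G i)"
    and "\<And>i. i \<in> I \<Longrightarrow> x i \<in> borel_measurable (G i)"
    and "\<And>i. i \<in> I \<Longrightarrow> integrable M (p i)"
    and "\<And>i A. i \<in> I \<Longrightarrow> A \<in> sets (G i) \<Longrightarrow> (LINT \<omega>:A|M. p i \<omega>) = 0"
    and "integrable M \<phi>"
    and "AE \<omega> in M. (\<Sum>i\<in>I. x i \<omega> * p i \<omega>) \<le> \<phi> \<omega>"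
  shows "integrable M (\<lambda>\<omega>. \<Sum>i\<in>I. x i \<omega> * p i \<omega>) \<and> (\<integral>\<omega>. (\<Sum>i\<in>I. x i \<omega> * p i \<omega>) \<partial>M) = 0"
  using assms(2-)
\<comment> \<open>Both \<open>p\<close> and \<open>\<phi>\<close> vary, as the inductive step
  replaces them by conditional expectations.\<close>
proof (induction I arbitrary: p \<phi> rule: finite_ranking_induct[where f = rank])
  case empty
  then show ?case by simp
next
  case (insert i I)
  interpret prob_space M by fact
  show ?case
  \<comment> \<open>The ranking induction does not promise that \<open>i\<close> is new; a repeated
    index leaves the sum unchanged.\<close>
  proof (cases "i \<in> I")
    case True
    then have *: "insert i I = I" by blast
    show ?thesis
      using insert.IH[of p \<phi>] insert.prems unfolding * by blast
  next
    case False
    let ?I = "insert i I"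
    have sub: "subalgebra M (G i)" using insert.prems by blast
    interpret finite_measure_subalgebra M "G i"
      by unfold_locales (rule sub)
    \<comment> \<open>Extension by zero makes integrability available for every index, not only for
      those in \<open>?I\<close>.\<close>
    define q where "q j \<omega> = (if j \<in> ?I then p j \<omega> else 0)" for j \<omega>
    have q_int [simp]: "integrable M (q j)" for j
      using insert.prems(4)[of j] unfolding q_def by (cases "j \<in> ?I") simp_all
    have q_meas [measurable]: "q j \<in> borel_measurable M" for j
      using borel_measurable_integrable[OF q_int] .
    have q_zero: "(LINT \<omega>:A|M. q j \<omega>) = 0" if "j \<in> ?I" "A \<in> sets (G j)" for j A
      using insert.prems(5)[OF that] that(1) unfolding q_def by simp
    \<comment> \<open>Conditioning preserves the orthogonality of the remaining indices:
      \<open>G j\<close> is contained in \<open>G i\<close>, as \<open>i\<close> has the largest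
      rank, so integrals over sets of \<open>G j\<close> do not change.\<close>
    define p' where "p' j = real_cond_exp M (G i) (q j)" for j
    define S where "S \<omega> = (\<Sum>j\<in>?I. x j \<omega> * p j \<omega>)" for \<omega>
    define S' where "S' \<omega> = (\<Sum>j\<in>I. x j \<omega> * p' j \<omega>)" for \<omega>
    have S_q: "S \<omega> = (\<Sum>j\<in>?I. x j \<omega> * q j \<omega>)" for \<omega>
      unfolding S_def q_def by (intro sum.cong) auto
    have subG: "subalgebra (G i) (G j)" if "j \<in> ?I" for j
      using insert.prems(2)[of j i] insert.hyps(2)[of j] that by auto
    have x_meas: "x j \<in> borel_measurable (G i)" if "j \<in> ?I" for j
      using measurable_from_subalg[OF subG[OF that] insert.prems(3)[OF that]] .
    have x_M: "x j \<in> borel_measurable M" if "j \<in> ?I" for j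
      using measurable_from_subalg[OF sub x_meas[OF that]] .
    have S_M [measurable]: "S \<in> borel_measurable M"
      unfolding S_q[abs_def] using x_M q_meas by (intro borel_measurable_sum borel_measurable_times) auto
    have p'_M [measurable]: "p' j \<in> borel_measurable M" for j
      unfolding p'_def by simp
    have p'_int: "integrable M (p' j)" for j
      unfolding p'_def by (rule real_cond_exp_int) simp
    have S'_M [measurable]: "S' \<in> borel_measurable M"
      unfolding S'_def[abs_def] using x_M by (intro borel_measurable_sum borel_measurable_times) auto
    \<comment> \<open>Zero integrals over all sets of \<open>G i\<close> characterize a vanishing
      conditional expectation.\<close>
    have p'_i: "AE \<omega> in M. p' i \<omega> = 0"
      unfolding p'_def
      by (rule real_cond_exp_charact) (use q_zero[of i] in auto)
    obtain A where A: "\<And>n. A n \<in> sets (G i)" and A_inc: "incseq A" and A_Un: "(\<Union>n. A n) = space (G i)"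
      and A_le: "\<And>n j \<omega>. j \<in> ?I \<Longrightarrow> \<omega> \<in> A n \<Longrightarrow> \<bar>x j \<omega>\<bar> \<le> real n"
      using bounded_truncation[of ?I x "G i"] x_meas insert.hyps(1) by blast
    have A_M [measurable]: "A n \<in> sets M" for n
      using A[of n] sub unfolding subalgebra_def by blast
    define X where "X n j \<omega> = indicator (A n) \<omega> * x j \<omega>" for n j \<omega>
    have X_G: "X n j \<in> borel_measurable (G i)" if "j \<in> ?I" for n j
      unfolding X_def[abs_def] using A x_meas[OF that] by (intro borel_measurable_times borel_measurable_indicator)
    have X_M: "X n j \<in> borel_measurable M" if "j \<in> ?I" for n j
      using measurable_from_subalg[OF sub X_G[OF that]] .
    have X_le: "\<bar>X n j \<omega>\<bar> \<le> real n" if "j \<in> ?I" for n j \<omega>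
      using A_le[OF that] unfolding X_def by (auto simp: indicator_def)
    have Xq_int: "integrable M (\<lambda>\<omega>. X n j \<omega> * f \<omega>)" if "j \<in> ?I" "integrable M f" for n j f
    proof (rule Bochner_Integration.integrable_bound[of _ "\<lambda>\<omega>. real n * f \<omega>"])
      show "integrable M (\<lambda>\<omega>. real n * f \<omega>)" using that by simp
      show "(\<lambda>\<omega>. X n j \<omega> * f \<omega>) \<in> borel_measurable M"
        using X_M[OF that(1)] that(2) by simp
      show "AE \<omega> in M. norm (X n j \<omega> * f \<omega>) \<le> norm (real n * f \<omega>)"
        using X_le[OF that(1)] by (auto simp: abs_mult intro!: mult_right_mono)
    qed
    have AS: "indicator (A n) \<omega> * S \<omega> = (\<Sum>j\<in>?I. X n j \<omega> * q j \<omega>)" for n \<omega>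
      unfolding S_q X_def sum_distrib_left by (simp add: mult.assoc)
    have AS': "indicator (A n) \<omega> * S' \<omega> = (\<Sum>j\<in>I. X n j \<omega> * p' j \<omega>)" for n \<omega>
      unfolding S'_def X_def sum_distrib_left by (simp add: mult.assoc)
    have AS_int: "integrable M (\<lambda>\<omega>. indicator (A n) \<omega> * S \<omega>)" for n
      unfolding AS by (intro Bochner_Integration.integrable_sum Xq_int) auto
    have AS'_int: "integrable M (\<lambda>\<omega>. indicator (A n) \<omega> * S' \<omega>)" for n
      unfolding AS' by (intro Bochner_Integration.integrable_sum Xq_int p'_int) auto
    have cond_AS: "AE \<omega> in M. real_cond_exp M (G i) (\<lambda>\<omega>. indicator (A n) \<omega> * S \<omega>) \<omega>
        = indicator (A n) \<omega> * S' \<omega>" for n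
    proof -
      \<comment> \<open>\<open>real_cond_exp_sum\<close> wants every member of the family
        integrable, hence again the extension by zero.\<close>
      define h where "h j \<omega> = (if j \<in> ?I then X n j \<omega> * q j \<omega> else 0)" for j \<omega>
      have h_int: "integrable M (h j)" for j
        using Xq_int[OF _ q_int, of j n j] unfolding h_def by (cases "j \<in> ?I") simp_all
      have h_sum: "(\<lambda>\<omega>. indicator (A n) \<omega> * S \<omega>) = (\<lambda>\<omega>. \<Sum>j\<in>?I. h j \<omega>)"
        unfolding AS h_def by (intro ext sum.cong) auto
      have "AE \<omega> in M. real_cond_exp M (G i) (\<lambda>\<omega>. \<Sum>j\<in>?I. h j \<omega>) \<omega>
          = (\<Sum>j\<in>?I. real_cond_exp M (G i) (h j) \<omega>)"
        by (rule real_cond_exp_sum) (rule h_int)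
      moreover have "AE \<omega> in M. \<forall>j\<in>?I. real_cond_exp M (G i) (h j) \<omega> = X n j \<omega> * p' j \<omega>"
      proof (rule AE_finite_allI)
        show "finite ?I" using insert.hyps by simp
        fix j assume j: "j \<in> ?I"
        have "h j = (\<lambda>\<omega>. X n j \<omega> * q j \<omega>)" using j unfolding h_def by auto
        then show "AE \<omega> in M. real_cond_exp M (G i) (h j) \<omega> = X n j \<omega> * p' j \<omega>"
          unfolding p'_def using real_cond_exp_mult[OF X_G[OF j] q_meas Xq_int[OF j q_int]] by simp
      qed
      ultimately show ?thesis
        using p'_i
      proof eventually_elim
        case (elim \<omega>)
        then show ?case
          unfolding h_sum AS' using insert.hyps(1) False by (simp add: sum.insert)
      qed
    qed
    have AS_eq: "(\<integral>\<omega>. indicator (A n) \<omega> * S \<omega> \<partial>M) = (\<integral>\<omega>. indicator (A n) \<omega> * S' \<omega> \<partial>M)" for n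
      using real_cond_exp_int(2)[OF AS_int[of n]] integral_cong_AE[OF _ _ cond_AS[of n]] by simp
    have S_le: "AE \<omega> in M. S \<omega> \<le> \<phi> \<omega>" using insert.prems(7) unfolding S_def .
    have phi_int: "integrable M \<phi>" by fact
    define \<phi>' where "\<phi>' = real_cond_exp M (G i) \<phi>"
    have phi'_int: "integrable M \<phi>'" unfolding \<phi>'_def by (rule real_cond_exp_int) fact
    have A_phi: "integrable M (\<lambda>\<omega>. indicator (A n) \<omega> * \<phi> \<omega>)" for n
      using integrable_mult_indicator[OF A_M phi_int] by simp
    \<comment> \<open>Integrability of \<open>S\<close> is not known yet, so the bound is
      conditioned only after restriction to \<open>A n\<close>; the countably many results are glued
      along the union.\<close>
    have S'_le: "AE \<omega> in M. S' \<omega> \<le> \<phi>' \<omega>"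
    proof -
      have "AE \<omega> in M. indicator (A n) \<omega> * S' \<omega> \<le> indicator (A n) \<omega> * \<phi>' \<omega>" for n
      proof -
        have "AE \<omega> in M. indicator (A n) \<omega> * S \<omega> \<le> indicator (A n) \<omega> * \<phi> \<omega>"
          using S_le by eventually_elim (auto simp: indicator_def)
        from real_cond_exp_mono[OF this AS_int[of n] A_phi[of n]] cond_AS[of n]
          real_cond_exp_mult[OF borel_measurable_indicator[OF A[of n]] borel_measurable_integrable[OF phi_int] A_phi[of n]]
        show ?thesis unfolding \<phi>'_def by eventually_elim simp
      qed
      then have "AE \<omega> in M. \<forall>n. indicator (A n) \<omega> * S' \<omega> \<le> indicator (A n) \<omega> * \<phi>' \<omega>"
        by (simp add: AE_all_countable)
      with AE_space show ?thesis
      proof eventually_elim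
        case (elim \<omega>)
        then obtain n where "\<omega> \<in> A n" using A_Un sub unfolding subalgebra_def by blast
        with elim(2)[rule_format, of n] show ?case by simp
      qed
    qed
    have IH: "integrable M S' \<and> (\<integral>\<omega>. S' \<omega> \<partial>M) = 0"
      unfolding S'_def
    proof (rule insert.IH)
      fix j B assume j: "j \<in> I" and B: "B \<in> sets (G j)"
      have "B \<in> sets (G i)" using B subG[of j] j unfolding subalgebra_def by blast
      then show "(LINT \<omega>:B|M. p' j \<omega>) = 0"
        unfolding p'_def using real_cond_exp_intA[OF q_int, of B j] q_zero[OF _ B] j by simp
    qed (use insert.prems S'_le p'_int phi'_int in \<open>auto simp: S'_def\<close>)
    have A_lim: "(\<lambda>n. indicator (A n) \<omega> :: real) \<longlonglongrightarrow> 1" if "\<omega> \<in> space M" for \<omega>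
      using LIMSEQ_indicator_incseq[OF A_inc, of \<omega>] A_Un sub that unfolding subalgebra_def by simp
    \<comment> \<open>The induction hypothesis supplies the dominating function for
      \<open>S'\<close>; through \<open>AS_eq\<close> the limit also holds for the truncated
      integrals of \<open>S\<close>.\<close>
    have lim_S': "(\<lambda>n. \<integral>\<omega>. indicator (A n) \<omega> * S' \<omega> \<partial>M) \<longlonglongrightarrow> (\<integral>\<omega>. S' \<omega> \<partial>M)"
    proof (rule integral_dominated_convergence[where w = "\<lambda>\<omega>. \<bar>S' \<omega>\<bar>"])
      show "AE \<omega> in M. (\<lambda>n. indicator (A n) \<omega> * S' \<omega>) \<longlonglongrightarrow> S' \<omega>"
        using tendsto_mult[OF A_lim tendsto_const[of "S' _"]] by (intro AE_I2) simp
    qed (use IH in \<open>auto simp: indicator_def\<close>)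
    have lim_phi: "(\<lambda>n. \<integral>\<omega>. indicator (A n) \<omega> * \<phi> \<omega> \<partial>M) \<longlonglongrightarrow> (\<integral>\<omega>. \<phi> \<omega> \<partial>M)"
    proof (rule integral_dominated_convergence[where w = "\<lambda>\<omega>. \<bar>\<phi> \<omega>\<bar>"])
      show "AE \<omega> in M. (\<lambda>n. indicator (A n) \<omega> * \<phi> \<omega>) \<longlonglongrightarrow> \<phi> \<omega>"
        using tendsto_mult[OF A_lim tendsto_const[of "\<phi> _"]] by (intro AE_I2) simp
    qed (use phi_int borel_measurable_integrable[OF phi_int] in \<open>auto simp: indicator_def\<close>)
    have diff_eq: "(\<integral>\<omega>. indicator (A n) \<omega> * (\<phi> \<omega> - S \<omega>) \<partial>M)
        = (\<integral>\<omega>. indicator (A n) \<omega> * \<phi> \<omega> \<partial>M) - (\<integral>\<omega>. indicator (A n) \<omega> * S' \<omega> \<partial>M)" for n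
      using Bochner_Integration.integral_diff[OF A_phi[of n] AS_int[of n]] AS_eq[of n]
      by (simp add: right_diff_distrib)
    have lim: "(\<lambda>n. \<integral>\<omega>. indicator (A n) \<omega> * (\<phi> \<omega> - S \<omega>) \<partial>M) \<longlonglongrightarrow> (\<integral>\<omega>. \<phi> \<omega> \<partial>M)"
      unfolding diff_eq using tendsto_diff[OF lim_phi lim_S'] IH by simp
    \<comment> \<open>The truncations increase because \<open>S \<le> \<phi>\<close> almost surely:
      the one-sided bound does the work of a dominating function.\<close>
    have "has_bochner_integral M (\<lambda>\<omega>. \<phi> \<omega> - S \<omega>) (\<integral>\<omega>. \<phi> \<omega> \<partial>M)"
    proof (rule has_bochner_integral_monotone_convergence[OF _ _ _ lim])
      show "integrable M (\<lambda>\<omega>. indicator (A n) \<omega> * (\<phi> \<omega> - S \<omega>))" for n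
        using Bochner_Integration.integrable_diff[OF A_phi[of n] AS_int[of n]] by (simp add: right_diff_distrib)
      show "AE \<omega> in M. mono (\<lambda>n. indicator (A n) \<omega> * (\<phi> \<omega> - S \<omega>))"
        using S_le
      proof eventually_elim
        case (elim \<omega>)
        show ?case
          using A_inc elim by (auto simp: mono_def indicator_def)
      qed
      show "AE \<omega> in M. (\<lambda>n. indicator (A n) \<omega> * (\<phi> \<omega> - S \<omega>)) \<longlonglongrightarrow> \<phi> \<omega> - S \<omega>"
        using tendsto_mult[OF A_lim tendsto_const[of "\<phi> _ - S _"]] by (intro AE_I2) simp
    qed (use borel_measurable_integrable[OF phi_int] in auto)
    then have "has_bochner_integral M (\<lambda>\<omega>. \<phi> \<omega> - (\<phi> \<omega> - S \<omega>)) ((\<integral>\<omega>. \<phi> \<omega> \<partial>M) - (\<integral>\<omega>. \<phi> \<omega> \<partial>M))"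
      using phi_int by (intro has_bochner_integral_diff) (auto simp: has_bochner_integral_iff)
    then show ?thesis
      unfolding S_def by (simp add: has_bochner_integral_iff)
  qed
qed

section \<open>Measurability for random sets, integrands and conjugates\<close>

text \<open>The open set \<open>W\<close> is a countable union of rectangles
  \<open>G \<times> H\<close> of basic open sets, and on a rectangle the condition splits into
  \<open>D\<close> hitting \<open>G\<close> and \<open>v\<close> lying in \<open>H\<close>.
  Measurability of membership, support functions and conjugates reduces to this lemma.\<close>

lemma measurable_Bex_random_set:
  fixes D :: "'a \<Rightarrow> 'b::second_countable_topology set" and v :: "'a \<Rightarrow> 'c::second_countable_topology"
  assumes D: "measurable_set_valued M D" and v: "v \<in> borel_measurable M" and W: "open W"
  shows "{\<omega> \<in> space M. \<exists>x\<in>D \<omega>. (x, v \<omega>) \<in> W} \<in> sets M"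
proof -
  obtain B :: "'b set set" where B: "countable B" "topological_basis B"
    using ex_countable_basis by blast
  obtain C :: "'c set set" where C: "countable C" "topological_basis C"
    using ex_countable_basis by blast
  define K where "K = {(G, H). G \<in> B \<and> H \<in> C \<and> G \<times> H \<subseteq> W}"
  have "countable K"
    by (rule countable_subset[OF _ countable_SIGMA[OF B(1) C(1)]]) (auto simp: K_def)
  have "{\<omega> \<in> space M. \<exists>x\<in>D \<omega>. (x, v \<omega>) \<in> W} =
      (\<Union>(G, H)\<in>K. {\<omega> \<in> space M. D \<omega> \<inter> G \<noteq> {}} \<inter> (v -` H \<inter> space M))"
  proof (intro equalityI subsetI)
    fix \<omega> assume "\<omega> \<in> {\<omega> \<in> space M. \<exists>x\<in>D \<omega>. (x, v \<omega>) \<in> W}"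
    then obtain x where x: "\<omega> \<in> space M" "x \<in> D \<omega>" "(x, v \<omega>) \<in> W" by blast
    from open_prod_elim[OF W x(3)] obtain G H
      where GH: "open G" "open H" "(x, v \<omega>) \<in> G \<times> H" "G \<times> H \<subseteq> W" by metis
    obtain G' where G': "G' \<in> B" "x \<in> G'" "G' \<subseteq> G"
      using topological_basisE[OF B(2) GH(1), of x] GH(3) by blast
    obtain H' where H': "H' \<in> C" "v \<omega> \<in> H'" "H' \<subseteq> H"
      using topological_basisE[OF C(2) GH(2), of "v \<omega>"] GH(3) by blast
    have "(G', H') \<in> K" using G' H' GH(4) unfolding K_def by blast
    then show "\<omega> \<in> (\<Union>(G, H)\<in>K. {\<omega> \<in> space M. D \<omega> \<inter> G \<noteq> {}} \<inter> (v -` H \<inter> space M))"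
      using x G' H' by blast
  next
    fix \<omega> assume "\<omega> \<in> (\<Union>(G, H)\<in>K. {\<omega> \<in> space M. D \<omega> \<inter> G \<noteq> {}} \<inter> (v -` H \<inter> space M))"
    then show "\<omega> \<in> {\<omega> \<in> space M. \<exists>x\<in>D \<omega>. (x, v \<omega>) \<in> W}" unfolding K_def by fastforce
  qed
  also have "\<dots> \<in> sets M"
  proof (intro sets.countable_UN'' \<open>countable K\<close>)
    fix z assume "z \<in> K"
    then obtain G H where z: "z = (G, H)" "G \<in> B" "H \<in> C" unfolding K_def by blast
    have "open G" "open H" using z B(2) C(2) topological_basis_open by blast+
    then show "(case z of (G, H) \<Rightarrow> {\<omega> \<in> space M. D \<omega> \<inter> G \<noteq> {}} \<inter> (v -` H \<inter> space M)) \<in> sets M"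
      using D v z(1) unfolding measurable_set_valued_def
      by (auto intro!: sets.Int measurable_sets[OF v])
  qed
  finally show ?thesis .
qed

text \<open>For a closed set, membership means that points of the set come arbitrarily near, and
  each degree of nearness is an open condition on the pair.\<close>

lemma measurable_mem_random_closed_set:
  fixes D :: "'a \<Rightarrow> 'b::{metric_space, second_countable_topology} set"
  assumes D: "measurable_set_valued M D" and cl: "\<And>\<omega>. \<omega> \<in> space M \<Longrightarrow> closed (D \<omega>)"
    and v: "v \<in> borel_measurable M"
  shows "{\<omega> \<in> space M. v \<omega> \<in> D \<omega>} \<in> sets M"
proof -
  have "open {(x::'b, z). dist x z < inverse (real (Suc n))}" for n
    by (auto simp: case_prod_unfold intro!: open_Collect_less continuous_intros)
  from measurable_Bex_random_set[OF D v this]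
  have "(\<Inter>n. {\<omega> \<in> space M. \<exists>x\<in>D \<omega>. dist x (v \<omega>) < inverse (real (Suc n))}) \<in> sets M"
    by (intro sets.countable_INT) auto
  also have "(\<Inter>n. {\<omega> \<in> space M. \<exists>x\<in>D \<omega>. dist x (v \<omega>) < inverse (real (Suc n))}) =
      {\<omega> \<in> space M. v \<omega> \<in> D \<omega>}"
  proof (intro equalityI subsetI)
    fix \<omega> assume \<omega>: "\<omega> \<in> (\<Inter>n. {\<omega> \<in> space M. \<exists>x\<in>D \<omega>. dist x (v \<omega>) < inverse (real (Suc n))})"
    have "\<exists>x\<in>D \<omega>. dist x (v \<omega>) < e" if "e > 0" for e
      using reals_Archimedean[OF that] \<omega> by (fastforce intro: less_trans)
    then have "v \<omega> \<in> closure (D \<omega>)" unfolding closure_approachable by blast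
    with \<omega> cl show "\<omega> \<in> {\<omega> \<in> space M. v \<omega> \<in> D \<omega>}" by auto
  qed (auto intro!: bexI)
  finally show ?thesis .
qed

text \<open>A supremum exceeds \<open>a\<close> exactly when one of its terms does, and
  \<open>a < x \<bullet> v\<close> is an open condition on \<open>(x, v)\<close>.\<close>

lemma borel_measurable_support_fun:
  fixes D :: "'a \<Rightarrow> 'b::euclidean_space set"
  assumes "measurable_set_valued M D" and "v \<in> borel_measurable M"
  shows "(\<lambda>\<omega>. support_fun (D \<omega>) (v \<omega>)) \<in> borel_measurable M"
proof (rule borel_measurableI_greater)
  fix a :: ereal
  have "open {z::'b \<times> 'b. a < ereal (fst z \<bullet> snd z)}"
    by (intro open_Collect_less continuous_intros)
  from measurable_Bex_random_set[OF assms this]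
  show "{\<omega> \<in> space M. a < support_fun (D \<omega>) (v \<omega>)} \<in> sets M"
    by (simp add: support_fun_def less_SUP_iff)
qed

text \<open>For real \<open>a\<close>, the event \<open>V \<omega> (u \<omega>) \<le> a\<close> says
  that \<open>(u \<omega>, a)\<close> lies in the epigraph, which is a random closed set.\<close>

lemma borel_measurable_integrand:
  fixes V :: "'a \<Rightarrow> 'b::euclidean_space \<Rightarrow> ereal"
  assumes V: "convex_normal_integrand M V" and u: "u \<in> borel_measurable M"
  shows "(\<lambda>\<omega>. V \<omega> (u \<omega>)) \<in> borel_measurable M"
proof -
  have le: "{\<omega> \<in> space M. V \<omega> (u \<omega>) \<le> ereal a} \<in> sets M" for a
    using measurable_mem_random_closed_set[of M "\<lambda>\<omega>. ereal_epigraph (V \<omega>)" "\<lambda>\<omega>. (u \<omega>, a)"] V u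
    unfolding convex_normal_integrand_def random_closed_convex_set_def by (simp add: ereal_epigraph_def)
  have "{\<omega> \<in> space M. V \<omega> (u \<omega>) \<le> a} \<in> sets M" for a
  proof (cases a)
    \<comment> \<open>An epigraph has only real levels, so the level -\<infinity> is reached as the
      intersection of the levels \<open>- real n\<close>.\<close>
    case MInf
    have "{\<omega> \<in> space M. V \<omega> (u \<omega>) \<le> a} = (\<Inter>n. {\<omega> \<in> space M. V \<omega> (u \<omega>) \<le> ereal (- real n)})"
      unfolding MInf
    proof (intro equalityI subsetI)
      fix \<omega> assume *: "\<omega> \<in> (\<Inter>n. {\<omega> \<in> space M. V \<omega> (u \<omega>) \<le> ereal (- real n)})"
      have "V \<omega> (u \<omega>) \<le> ereal r" for r
      proof -
        obtain n :: nat where "- r \<le> real n" using real_arch_simple by blast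
        then have "ereal (- real n) \<le> ereal r" by simp
        with * show ?thesis by (blast intro: order_trans)
      qed
      then show "\<omega> \<in> {\<omega> \<in> space M. V \<omega> (u \<omega>) \<le> - \<infinity>}" using * by (auto intro: ereal_bot)
    qed auto
    also have "\<dots> \<in> sets M" using le by (intro sets.countable_INT) auto
    finally show ?thesis .
  qed (use le in auto)
  then show ?thesis
    by (intro borel_measurable_iff_Iic_ereal[THEN iffD2]) (simp add: vimage_def Int_def conj_commute)
qed

text \<open>Against \<open>(v, -1)\<close> an epigraph point \<open>(x, \<alpha>)\<close> has the
  value \<open>x \<bullet> v - \<alpha>\<close>, which grows as \<alpha> decreases to
  \<open>f x\<close>. Thus the conjugate of an integrand becomes the support function of a random
  closed set.\<close>

lemma conjugate_eq_support_fun_epigraph: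
  "conjugate_on UNIV f v = support_fun (ereal_epigraph f) (v, -1)"
proof (rule antisym)
  show "conjugate_on UNIV f v \<le> support_fun (ereal_epigraph f) (v, -1)"
    unfolding conjugate_on_def
  proof (rule SUP_least)
    fix x
    have *: "ereal (x \<bullet> v) - ereal \<alpha> \<le> support_fun (ereal_epigraph f) (v, -1)" if "f x \<le> ereal \<alpha>" for \<alpha>
      unfolding support_fun_def
      by (rule SUP_upper2[of "(x, \<alpha>)"]) (use that in \<open>auto simp: ereal_epigraph_def\<close>)
    show "ereal (x \<bullet> v) - f x \<le> support_fun (ereal_epigraph f) (v, -1)"
    proof (cases "f x")
      case (real r)
      then show ?thesis using *[of r] by simp
    next
      \<comment> \<open>The term of the conjugate is \<infinity>, and every real \<alpha> is
        admissible, so the support function is unbounded as well.\<close>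
      case MInf
      have "ereal r \<le> support_fun (ereal_epigraph f) (v, -1)" for r
        using *[of "x \<bullet> v - r"] MInf by simp
      then have "support_fun (ereal_epigraph f) (v, -1) = \<infinity>"
        by (rule ereal_top)
      then show ?thesis by simp
    qed simp
  qed
  show "support_fun (ereal_epigraph f) (v, -1) \<le> conjugate_on UNIV f v"
    unfolding support_fun_def
  proof (rule SUP_least)
    fix z assume z: "z \<in> ereal_epigraph f"
    obtain x \<alpha> where xa: "z = (x, \<alpha>)" by fastforce
    have "ereal (z \<bullet> (v, -1)) \<le> ereal (x \<bullet> v) - f x"
      using z xa by (cases "f x") (auto simp: ereal_epigraph_def)
    also have "\<dots> \<le> conjugate_on UNIV f v"
      unfolding conjugate_on_def by (rule SUP_upper) simp
    finally show "ereal (z \<bullet> (v, -1)) \<le> conjugate_on UNIV f v" .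
  qed
qed

lemma borel_measurable_conjugate_integrand:
  fixes V :: "'a \<Rightarrow> 'b::euclidean_space \<Rightarrow> ereal"
  assumes "convex_normal_integrand M V" and "v \<in> borel_measurable M"
  shows "(\<lambda>\<omega>. conjugate_on UNIV (V \<omega>) (v \<omega>)) \<in> borel_measurable M"
  unfolding conjugate_eq_support_fun_epigraph
  using assms unfolding convex_normal_integrand_def random_closed_convex_set_def
  by (intro borel_measurable_support_fun) auto

text \<open>Off the subspace \<open>f\<close> is arbitrary, so it is composed with the coordinate
  projection. The result is finite and convex on the whole Euclidean space, hence
  continuous.\<close>

lemma convex_on_coord_space_continuous:
  assumes "convex_on (coord_space J) f"
  obtains g where "continuous_on UNIV g" and "\<And>x. x \<in> coord_space J \<Longrightarrow> g x = f x"
proof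
  define P :: "real ^ 'a \<Rightarrow> real ^ 'a" where "P x = (\<chi> j. if j \<in> J then x $ j else 0)" for x
  have "convex_on UNIV (\<lambda>x. f (P x))"
  proof (rule convex_onI)
    fix t :: real and x y assume t: "0 < t" "t < 1"
    have P: "P ((1 - t) *\<^sub>R x + t *\<^sub>R y) = (1 - t) *\<^sub>R P x + t *\<^sub>R P y"
      unfolding P_def by (simp add: vec_eq_iff)
    show "f (P ((1 - t) *\<^sub>R x + t *\<^sub>R y)) \<le> (1 - t) * f (P x) + t * f (P y)"
      unfolding P using t by (intro convex_onD[OF assms]) (auto simp: P_def coord_space_def)
  qed simp
  then show "continuous_on UNIV (\<lambda>x. f (P x))"
    by (intro convex_on_continuous) auto
  show "f (P x) = f x" if "x \<in> coord_space J" for x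
  proof -
    have "P x = x" using that unfolding P_def coord_space_def by (auto simp: vec_eq_iff)
    then show ?thesis by simp
  qed
qed

text \<open>The factor \<open>y\<close> carries no sign, so \<open>y * f\<close> need not be convex
  and the epigraph argument for convex integrands does not apply. Instead
  \<open>x \<bullet> v - y * g x\<close> is jointly continuous in \<open>(x, v, y)\<close>, where
  \<open>g\<close> is a continuous extension of \<open>f\<close>.\<close>

lemma borel_measurable_conjugate_scaled:
  fixes f :: "real ^ 'j \<Rightarrow> real"
  assumes f: "convex_on (coord_space J) f"
    and v: "v \<in> borel_measurable M" and y: "y \<in> borel_measurable M"
  shows "(\<lambda>\<omega>. conjugate_on (coord_space J) (\<lambda>x. ereal (y \<omega> * f x)) (v \<omega>)) \<in> borel_measurable M"
proof (rule borel_measurableI_greater)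
  fix a :: ereal
  obtain g where g: "continuous_on UNIV g" "\<And>x. x \<in> coord_space J \<Longrightarrow> g x = f x"
    using convex_on_coord_space_continuous[OF f] by blast
  have "open {z::(real ^ 'j) \<times> (real ^ 'j) \<times> real. a < ereal (fst z \<bullet> fst (snd z) - snd (snd z) * g (fst z))}"
    by (intro open_Collect_less continuous_intros continuous_on_compose2[OF g(1)]) auto
  moreover have "measurable_set_valued M (\<lambda>\<omega>. coord_space J :: (real ^ 'j) set)"
    unfolding measurable_set_valued_def by simp
  moreover have "(\<lambda>\<omega>. (v \<omega>, y \<omega>)) \<in> borel_measurable M"
    using v y by simp
  ultimately have "{\<omega> \<in> space M. \<exists>x\<in>coord_space J. (x, v \<omega>, y \<omega>) \<in>
      {z. a < ereal (fst z \<bullet> fst (snd z) - snd (snd z) * g (fst z))}} \<in> sets M"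
    by (intro measurable_Bex_random_set)
  then show "{\<omega> \<in> space M. a < conjugate_on (coord_space J) (\<lambda>x. ereal (y \<omega> * f x)) (v \<omega>)} \<in> sets M"
    by (simp add: conjugate_on_def less_SUP_iff g(2) cong: bex_cong)
qed

section \<open>Equality in the Fenchel inequality\<close>

lemma fenchel_young_on:
  assumes "x \<in> E"
  shows "ereal (x \<bullet> v) - f x \<le> conjugate_on E f v"
  unfolding conjugate_on_def using assms by (rule SUP_upper)

text \<open>Both sides say that \<open>x\<close> attains the supremum defining the conjugate at
  \<open>v\<close>. Finite values turn this into an equation of real numbers.\<close>

lemma subdifferential_on_iff_fenchel_equality:
  assumes "x \<in> E" and "v \<in> E" and fx: "f x = ereal a" and conj: "conjugate_on E f v = ereal b"
  shows "v \<in> subdifferential_on E f x \<longleftrightarrow> a + b = x \<bullet> v"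
proof
  assume sub: "v \<in> subdifferential_on E f x"
  have "conjugate_on E f v \<le> ereal (x \<bullet> v - a)"
    unfolding conjugate_on_def
  proof (rule SUP_least)
    fix x' assume "x' \<in> E"
    then have "f x + ereal (v \<bullet> (x' - x)) \<le> f x'" using sub unfolding subdifferential_on_def by blast
    then show "ereal (x' \<bullet> v) - f x' \<le> ereal (x \<bullet> v - a)"
      unfolding fx by (cases "f x'") (auto simp: inner_diff_right inner_commute[of v])
  qed
  moreover have "ereal (x \<bullet> v - a) \<le> conjugate_on E f v"
    using fenchel_young_on[OF \<open>x \<in> E\<close>, of v f] fx by simp
  ultimately show "a + b = x \<bullet> v" unfolding conj by simp
next
  assume eq: "a + b = x \<bullet> v"
  show "v \<in> subdifferential_on E f x"
    unfolding subdifferential_on_def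
  proof (intro CollectI conjI ballI \<open>v \<in> E\<close>)
    fix x' assume "x' \<in> E"
    from fenchel_young_on[OF this, of v f]
    show "f x + ereal (v \<bullet> (x' - x)) \<le> f x'"
      unfolding fx conj using eq by (cases "f x'") (auto simp: inner_diff_right inner_commute[of v])
  qed
qed

lemma support_fun_upper: "x \<in> D \<Longrightarrow> ereal (x \<bullet> v) \<le> support_fun D v"
  unfolding support_fun_def by (rule SUP_upper)

text \<open>Both sides say that the linear function given by \<open>v\<close> attains its maximum
  over \<open>D\<close> at \<open>x\<close>.\<close>

lemma normal_cone_on_iff_support_fun_eq:
  assumes "x \<in> D" and "v \<in> E" and sup: "support_fun D v = ereal b"
  shows "v \<in> normal_cone_on E D x \<longleftrightarrow> x \<bullet> v = b"
proof
  assume "v \<in> normal_cone_on E D x"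
  then have "x' \<bullet> v \<le> x \<bullet> v" if "x' \<in> D" for x'
    using assms(1) that unfolding normal_cone_on_def by (auto simp: inner_diff_right inner_commute[of v])
  then have "support_fun D v \<le> ereal (x \<bullet> v)"
    unfolding support_fun_def by (intro SUP_least) simp
  with support_fun_upper[OF assms(1), of v] show "x \<bullet> v = b" unfolding sup by simp
next
  assume eq: "x \<bullet> v = b"
  have "v \<bullet> (x' - x) \<le> 0" if "x' \<in> D" for x'
    using support_fun_upper[OF that, of v] eq unfolding sup by (simp add: inner_diff_right inner_commute[of v])
  then show "v \<in> normal_cone_on E D x" using assms(1,2) unfolding normal_cone_on_def by simp
qed

section \<open>Extended expectations and integrals\<close>

text \<open>By its convention \<open>ext_expectation\<close> stays below \<infinity> only if the
  positive part has a finite integral. The negative part remains uncontrolled, hence the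
  \<open>max 0\<close>.\<close>

lemma ext_expectation_less_infinityD:
  assumes X: "X \<in> borel_measurable M" and fin: "ext_expectation M X < \<infinity>"
  shows "AE \<omega> in M. X \<omega> < \<infinity>" and "integrable M (\<lambda>\<omega>. max 0 (real_of_ereal (X \<omega>)))"
proof -
  have fin': "(\<integral>\<^sup>+\<omega>. e2ennreal (X \<omega>) \<partial>M) \<noteq> \<infinity>"
    using fin unfolding ext_expectation_def by (auto split: if_splits)
  have "(\<lambda>\<omega>. e2ennreal (X \<omega>)) \<in> borel_measurable M" using X by simp
  from nn_integral_PInf_AE[OF this fin']
  show "AE \<omega> in M. X \<omega> < \<infinity>"
    by eventually_elim auto
  show "integrable M (\<lambda>\<omega>. max 0 (real_of_ereal (X \<omega>)))"
  proof (rule integrableI_bounded)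
    have "(\<integral>\<^sup>+\<omega>. ennreal (norm (max 0 (real_of_ereal (X \<omega>)))) \<partial>M) \<le> (\<integral>\<^sup>+\<omega>. e2ennreal (X \<omega>) \<partial>M)"
    proof (rule nn_integral_mono)
      fix \<omega>
      \<comment> \<open>\<open>real_of_ereal\<close> sends both infinities to 0, so infinite values
        do no harm.\<close>
      show "ennreal (norm (max 0 (real_of_ereal (X \<omega>)))) \<le> e2ennreal (X \<omega>)"
        by (cases "X \<omega>") (auto simp: max_def ennreal_neg)
    qed
    with fin' show "(\<integral>\<^sup>+\<omega>. ennreal (norm (max 0 (real_of_ereal (X \<omega>)))) \<partial>M) < \<infinity>"
      by (auto simp: less_top top_unique)
  qed (use X in simp)
qed

lemma ext_expectation_eq_integral:
  assumes "AE \<omega> in M. X \<omega> = ereal (f \<omega>)" and f: "integrable M f"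
  shows "ext_expectation M X = ereal (\<integral>\<omega>. f \<omega> \<partial>M)"
proof -
  have p: "(\<integral>\<^sup>+\<omega>. e2ennreal (X \<omega>) \<partial>M) = (\<integral>\<^sup>+\<omega>. ennreal (f \<omega>) \<partial>M)"
    using assms(1) by (intro nn_integral_cong_AE) auto
  have n: "(\<integral>\<^sup>+\<omega>. e2ennreal (- X \<omega>) \<partial>M) = (\<integral>\<^sup>+\<omega>. ennreal (- f \<omega>) \<partial>M)"
    using assms(1) by (intro nn_integral_cong_AE) auto
  obtain r q where rq: "(\<integral>\<^sup>+\<omega>. ennreal (f \<omega>) \<partial>M) = ennreal r" "(\<integral>\<^sup>+\<omega>. ennreal (- f \<omega>) \<partial>M) = ennreal q"
      "0 \<le> r" "0 \<le> q"
    using f unfolding real_integrable_def by (metis ennreal_cases infinity_ennreal_def)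
  then show ?thesis
    unfolding ext_expectation_def p n real_lebesgue_integral_def[OF f] by simp
qed

section \<open>Components of strategies, test vectors and the annihilator\<close>

lemma borel_measurable_vec_iff:
  fixes f :: "'a \<Rightarrow> real ^ 'j"
  shows "f \<in> borel_measurable M \<longleftrightarrow> (\<forall>j. (\<lambda>\<omega>. f \<omega> $ j) \<in> borel_measurable M)"
proof -
  have basis: "(Basis :: (real ^ 'j) set) = range (\<lambda>j. axis j 1)"
    by (auto simp: Basis_vec_def)
  have comp: "(\<lambda>\<omega>. f \<omega> \<bullet> axis j 1) = (\<lambda>\<omega>. f \<omega> $ j)" for j
    by (rule ext) (simp add: inner_axis)
  have "(\<forall>i\<in>range (\<lambda>j. axis j 1). P i) \<longleftrightarrow> (\<forall>j. P (axis j 1))" for P :: "real ^ 'j \<Rightarrow> bool"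
    by blast
  from this[of "\<lambda>i. (\<lambda>\<omega>. f \<omega> \<bullet> i) \<in> borel_measurable M"] show ?thesis
    unfolding borel_measurable_euclidean_space[of f] basis comp .
qed

text \<open>Apply decomposability to the zero vector and the empty set: \<open>u\<close> then
  replaces zero everywhere.\<close>

lemma L_infty_subset_dual_space:
  assumes "dual_spaces M I L L'"
  shows "L_infty M I \<subseteq> L"
proof
  fix u assume "u \<in> L_infty M I"
  moreover have "(\<lambda>\<omega> i. 0) \<in> L" "decomposable M I L"
    using assms unfolding dual_spaces_def linear_space_rv_def by auto
  ultimately have "(\<lambda>\<omega>. if \<omega> \<in> {} then (\<lambda>i. 0) else u \<omega>) \<in> L"
    unfolding decomposable_def by fastforce
  then show "u \<in> L" by simp
qed

text \<open>These are the test vectors: pairing with one of them isolates the integral of a single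
  component over \<open>A\<close>.\<close>

lemma indicator_component_L_infty:
  assumes "A \<in> sets M" and "i \<in> I"
  shows "(\<lambda>\<omega> k. if k = i then indicator A \<omega> else 0) \<in> L_infty M I"
  unfolding L_infty_def L0_def
proof (intro CollectI conjI ballI allI impI)
  show "(\<lambda>\<omega>. if k = i then indicator A \<omega> else 0 :: real) \<in> borel_measurable M" for k
    using assms(1) by (cases "k = i") auto
  show "\<exists>C. AE \<omega> in M. \<forall>k\<in>I. \<bar>if k = i then indicator A \<omega> else 0 :: real\<bar> \<le> C"
    by (intro exI[of _ 1] AE_I2) (auto simp: indicator_def)
qed (use assms(2) in auto)

lemma sum_single_component:
  fixes f g :: "'i \<Rightarrow> real"
  assumes "finite I" and "i \<in> I"
  shows "(\<Sum>k\<in>I. (if k = i then b else 0) * f k) = b * f i"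
proof -
  have "(\<Sum>k\<in>I. (if k = i then b else 0) * f k) = (\<Sum>k\<in>I. if k = i then b * f k else 0)"
    by (intro sum.cong) auto
  then show ?thesis using assms by simp
qed

text \<open>Duality gives integrability only of the sum of products; the test vector with
  \<open>A = space M\<close> singles out one component.\<close>

lemma dual_space_component_integrable:
  assumes dual: "dual_spaces M I L L'" and "finite I" and "v \<in> L'" and "i \<in> I"
  shows "integrable M (\<lambda>\<omega>. v \<omega> i)"
proof -
  let ?x = "\<lambda>\<omega> k. if k = i then indicator (space M) \<omega> else 0 :: real"
  have "?x \<in> L"
    using indicator_component_L_infty[of "space M" M i I] L_infty_subset_dual_space[OF dual] \<open>i \<in> I\<close> by auto
  have all: "\<forall>x\<in>L. \<forall>v\<in>L'. integrable M (\<lambda>\<omega>. \<Sum>k\<in>I. x \<omega> k * v \<omega> k)"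
    using dual unfolding dual_spaces_def separating_duality_def by simp
  have "integrable M (\<lambda>\<omega>. \<Sum>k\<in>I. ?x \<omega> k * v \<omega> k)"
    using all[THEN bspec, OF \<open>?x \<in> L\<close>, THEN bspec, OF \<open>v \<in> L'\<close>] .
  then have "integrable M (\<lambda>\<omega>. indicator (space M) \<omega> * v \<omega> i)"
    unfolding sum_single_component[OF \<open>finite I\<close> \<open>i \<in> I\<close>] .
  then show ?thesis
    by (rule Bochner_Integration.integrable_cong[THEN iffD1, rotated 2]) auto
qed

text \<open>Times are shifted by one, so that the static components, known at time -1, rank below
  all dynamic ones while ranks stay natural numbers.\<close>

fun index_time :: "'b + nat \<times> 'j \<Rightarrow> nat" where
  "index_time (Inl j) = 0"
| "index_time (Inr (t, j)) = Suc t"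

fun index_info :: "'a measure \<Rightarrow> (nat \<Rightarrow> 'a measure) \<Rightarrow> 'b + nat \<times> 'j \<Rightarrow> 'a measure" where
  "index_info M F (Inl j) = sigma (space M) {}"
| "index_info M F (Inr (t, j)) = F t"

lemma finite_strategy_index [simp]:
  "finite (strategy_index T (J :: 'j::finite set) (Jb :: 'jb::finite set))"
  unfolding strategy_index_def by simp

lemma adapted_strategy_component_measurable:
  assumes "x \<in> adapted_strategies M F T J Jb" and "i \<in> strategy_index T J Jb"
  shows "(\<lambda>\<omega>. x \<omega> i) \<in> borel_measurable (index_info M F i)"
proof -
  have *: "(\<lambda>\<omega>. static_part (x \<omega>)) \<in> borel_measurable (sigma (space M) {})"
    "t < T \<Longrightarrow> (\<lambda>\<omega>. dynamic_part (x \<omega>) t) \<in> borel_measurable (F t)" for t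
    using assms(1) unfolding adapted_strategies_def by simp_all
  have static: "(\<lambda>\<omega>. x \<omega> (Inl j)) \<in> borel_measurable (sigma (space M) {})" for j
    using *(1)[unfolded borel_measurable_vec_iff static_part_def vec_lambda_beta] by (rule spec)
  have dynamic: "(\<lambda>\<omega>. x \<omega> (Inr (t, j))) \<in> borel_measurable (F t)" if "t < T" for t j
    using *(2)[OF that, unfolded borel_measurable_vec_iff dynamic_part_def vec_lambda_beta] by (rule spec)
  show ?thesis
  proof (cases i)
    case (Inl j)
    show ?thesis unfolding Inl index_info.simps by (rule static)
  next
    case (Inr k)
    obtain t j where k: "k = (t, j)" by (cases k)
    have "t < T" using assms(2) unfolding Inr k strategy_index_def by blast
    then show ?thesis unfolding Inr k index_info.simps by (rule dynamic)
  qed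
qed

text \<open>The other components are constantly zero, hence measurable for every sigma-algebra; only
  the information of component \<open>i\<close> constrains \<open>A\<close>.\<close>

lemma indicator_component_adapted:
  fixes M :: "'a measure"
  assumes i: "i \<in> strategy_index T J Jb" and A: "A \<in> sets (index_info M F i)" and "A \<in> sets M"
  shows "(\<lambda>\<omega> k. if k = i then indicator A \<omega> else 0) \<in> adapted_strategies M F T J Jb"
proof -
  have L0: "(\<lambda>\<omega> k. if k = i then indicator A \<omega> else 0) \<in> L0 M (strategy_index T J Jb)"
    using indicator_component_L_infty[OF \<open>A \<in> sets M\<close> i] unfolding L_infty_def by simp
  have info: "(\<lambda>\<omega>. if k = i then indicator A \<omega> else 0 :: real) \<in> borel_measurable (index_info M F k)" for k
  proof (cases "k = i")
    case True
    then show ?thesis using borel_measurable_indicator[OF A] by simp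
  next
    case False
    then show ?thesis by simp
  qed
  have static: "(\<lambda>\<omega>. if Inl j = i then indicator A \<omega> else 0 :: real) \<in> borel_measurable (sigma (space M) {})" for j
    using info[of "Inl j"] unfolding index_info.simps .
  have dynamic: "(\<lambda>\<omega>. if Inr (t, j) = i then indicator A \<omega> else 0 :: real) \<in> borel_measurable (F t)" for t j
    using info[of "Inr (t, j)"] unfolding index_info.simps .
  show ?thesis
    unfolding adapted_strategies_def borel_measurable_vec_iff static_part_def dynamic_part_def vec_lambda_beta
    by (rule CollectI, intro conjI allI impI) (rule L0 static dynamic)+
qed

lemma sum_strategy_index:
  fixes x p :: "'jb::finite + nat \<times> 'j::finite \<Rightarrow> real"
  assumes "\<And>i. i \<notin> strategy_index T J Jb \<Longrightarrow> x i = 0"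
  shows "(\<Sum>i\<in>strategy_index T J Jb. x i * p i) =
    (\<Sum>t<T. dynamic_part x t \<bullet> dynamic_part p t) + static_part x \<bullet> static_part p"
proof -
  \<comment> \<open>Inner products run over the whole index types; outside \<open>J\<close> and
    \<open>Jb\<close> the products vanish with \<open>x\<close>.\<close>
  have "(\<Sum>i\<in>strategy_index T J Jb. x i * p i) =
      (\<Sum>i\<in>Inl ` UNIV \<union> Inr ` ({..<T} \<times> UNIV). x i * p i)"
    using assms by (intro sum.mono_neutral_left) (auto simp: strategy_index_def)
  also have "\<dots> = (\<Sum>i\<in>Inl ` UNIV. x i * p i) + (\<Sum>i\<in>Inr ` ({..<T} \<times> UNIV). x i * p i)"
    by (intro sum.union_disjoint) auto
  also have "\<dots> = (\<Sum>j\<in>UNIV. x (Inl j) * p (Inl j)) + (\<Sum>t<T. \<Sum>j\<in>UNIV. x (Inr (t, j)) * p (Inr (t, j)))"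
    unfolding sum.cartesian_product by (simp add: sum.reindex comp_def case_prod_unfold)
  finally show ?thesis
    by (simp add: inner_vec_def static_part_def dynamic_part_def)
qed

lemma trivial_sigma_subalgebra:
  "subalgebra N (sigma (space N) {})"
  unfolding subalgebra_def by (simp add: sigma_sets_empty_eq)

lemma index_info_subalgebra:
  assumes sub: "\<And>t. t \<le> T \<Longrightarrow> subalgebra M (F t)" and "i \<in> strategy_index T J Jb"
  shows "subalgebra M (index_info M F i)"
proof (cases i)
  case (Inl j)
  show ?thesis unfolding Inl index_info.simps by (rule trivial_sigma_subalgebra)
next
  case (Inr k)
  obtain t j where k: "k = (t, j)" by (cases k)
  have "t < T" using assms(2) unfolding Inr k strategy_index_def by blast
  then show ?thesis unfolding Inr k index_info.simps by (intro sub) simp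
qed

lemma index_info_mono:
  assumes filt: "filtration (space M) (\<lambda>t. F (min t T))"
    and ij: "i \<in> strategy_index T J Jb" "j \<in> strategy_index T J Jb" "index_time i \<le> index_time j"
    and sub: "subalgebra M (index_info M F j)"
  shows "subalgebra (index_info M F j) (index_info M F i)"
proof (cases i)
  case (Inl j0)
  have "space (index_info M F j) = space M"
    using sub unfolding subalgebra_def by (rule conjunct1)
  then show ?thesis
    using trivial_sigma_subalgebra[of "index_info M F j"] unfolding Inl by simp
next
  case (Inr k)
  obtain t0 j0 where k: "k = (t0, j0)" by (cases k)
  \<comment> \<open>A dynamic \<open>i\<close> has rank at least 1, which excludes a static
    \<open>j\<close>.\<close>
  obtain t1 j1 where j: "j = Inr (t1, j1)"
    using ij(3) unfolding Inr k by (cases j rule: index_time.cases) simp_all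
  have t: "t0 \<le> t1" "t1 < T"
    using ij(2,3) unfolding Inr k j strategy_index_def by auto
  have "sets (F (min t0 T)) \<subseteq> sets (F (min t1 T))"
    by (rule filtration.sets_F_mono[OF filt t(1)])
  \<comment> \<open>The filtration is frozen from \<open>T\<close> on; both times lie before
    that.\<close>
  moreover have "min t0 T = t0" "min t1 T = t1" using t by simp_all
  moreover have "space (F (min t0 T)) = space M" "space (F (min t1 T)) = space M"
    by (rule filtration.space_F[OF filt])+
  ultimately show ?thesis
    unfolding Inr k j subalgebra_def by simp
qed

lemma adapted_annihilator_integral_zero:
  assumes sub: "subalgebra M (index_info M F i)"
    and dual: "dual_spaces M (strategy_index T J Jb) XX VV"
    and p: "p \<in> adapted_annihilator M F T J Jb XX VV"
    and i: "i \<in> strategy_index T J Jb" and A: "A \<in> sets (index_info M F i)"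
  shows "(LINT \<omega>:A|M. p \<omega> i) = 0"
proof -
  let ?x = "\<lambda>\<omega> k. if k = i then indicator A \<omega> else 0 :: real"
  have A_M: "A \<in> sets M" using A sub unfolding subalgebra_def by blast
  have "?x \<in> XX"
    by (rule subsetD[OF L_infty_subset_dual_space[OF dual] indicator_component_L_infty[OF A_M i]])
  then have x: "?x \<in> XX \<inter> adapted_strategies M F T J Jb"
    using indicator_component_adapted[OF i A A_M] by (rule IntI)
  have "\<forall>x\<in>XX \<inter> adapted_strategies M F T J Jb. pairing M (strategy_index T J Jb) x p = 0"
    using p unfolding adapted_annihilator_def by simp
  from this[THEN bspec, OF x] show ?thesis
    unfolding pairing_def sum_single_component[OF finite_strategy_index i] set_lebesgue_integral_def by simp
qed

text \<open>Here \<open>x\<close> may lie outside \<open>XX\<close>: the annihilator property enters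
  only through integrals of single components over known sets.\<close>

lemma adapted_annihilator_pairing_zero:
  fixes J :: "'j::finite set" and Jb :: "'jb::finite set"
  assumes "prob_space M" and filt: "filtration (space M) (\<lambda>t. F (min t T))"
    and sub: "\<And>t. t \<le> T \<Longrightarrow> subalgebra M (F t)"
    and dual: "dual_spaces M (strategy_index T J Jb) XX VV"
    and x: "x \<in> adapted_strategies M F T J Jb"
    and p: "p \<in> adapted_annihilator M F T J Jb XX VV"
    and \<phi>: "integrable M \<phi>"
    and le: "AE \<omega> in M. (\<Sum>i\<in>strategy_index T J Jb. x \<omega> i * p \<omega> i) \<le> \<phi> \<omega>"
  shows "integrable M (\<lambda>\<omega>. \<Sum>i\<in>strategy_index T J Jb. x \<omega> i * p \<omega> i) \<and>
    (\<integral>\<omega>. (\<Sum>i\<in>strategy_index T J Jb. x \<omega> i * p \<omega> i) \<partial>M) = 0"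
proof -
  let ?I = "strategy_index T J Jb"
  have subM: "subalgebra M (index_info M F i)" if "i \<in> ?I" for i
    by (rule index_info_subalgebra[OF sub that])
  have "p \<in> VV" using p unfolding adapted_annihilator_def by simp
  note p_int = dual_space_component_integrable[OF dual finite_strategy_index this]
  show ?thesis
    by (rule adapted_orthogonal_integral_zero[where G = "index_info M F" and rank = index_time
          and x = "\<lambda>i \<omega>. x \<omega> i" and p = "\<lambda>i \<omega>. p \<omega> i",
          OF \<open>prob_space M\<close> finite_strategy_index subM index_info_mono[OF filt _ _ _ subM]
          adapted_strategy_component_measurable[OF x] p_int
          adapted_annihilator_integral_zero[OF subM dual p] \<phi> le])
qed

section \<open>The pointwise duality gap\<close>

text \<open>Finiteness comes first: \<open>0 \<in> D t\<close> and \<open>S0 0 = 0\<close> keep the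
  support terms and the last conjugate nonnegative, and \<open>v w\<close> and the conjugate of
  \<open>v\<close> bound each other from below. With the two upper bounds every term is real, and
  the gap becomes a sum of real nonnegative gaps.\<close>

lemma pointwise_fenchel_gap:
  fixes v :: "real \<Rightarrow> ereal" and D :: "nat \<Rightarrow> (real ^ 'j) set" and S0 :: "real ^ 'jb \<Rightarrow> real"
    and x p d :: "nat \<Rightarrow> real ^ 'j" and xb pb cb :: "real ^ 'jb" and Jb :: "'jb set"
    and T :: nat and c y :: real
  defines "w \<equiv> c - (\<Sum>t<T. x t \<bullet> d t) - cb \<bullet> xb + S0 xb"
    and "B \<equiv> conjugate_on UNIV v y + (\<Sum>t<T. support_fun (D t) (p t + y *\<^sub>R d t))
          + conjugate_on (coord_space Jb) (\<lambda>z. ereal (y * S0 z)) (pb + y *\<^sub>R cb)"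
  assumes "S0 0 = 0"
    and zero: "\<And>t. t < T \<Longrightarrow> 0 \<in> D t"
    and x: "\<And>t. t < T \<Longrightarrow> x t \<in> D t"
    and xb: "xb \<in> coord_space Jb"
    and pd: "\<And>t. t < T \<Longrightarrow> p t + y *\<^sub>R d t \<in> coord_space J"
    and pb: "pb + y *\<^sub>R cb \<in> coord_space Jb"
    and "v w < \<infinity>" and "B < \<infinity>"
  obtains a b where "v w = ereal a" and "B = ereal b"
    and "c * y + ((\<Sum>t<T. x t \<bullet> p t) + xb \<bullet> pb) \<le> a + b"
    and "a + b = c * y + ((\<Sum>t<T. x t \<bullet> p t) + xb \<bullet> pb) \<longleftrightarrow>
      y \<in> subdifferential_on UNIV v w \<and>
      (\<forall>t<T. p t + y *\<^sub>R d t \<in> normal_cone_on (coord_space J) (D t) (x t)) \<and>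
      pb + y *\<^sub>R cb \<in> subdifferential_on (coord_space Jb) (\<lambda>z. ereal (y * S0 z)) xb"
proof -
  let ?\<sigma> = "\<lambda>t. support_fun (D t) (p t + y *\<^sub>R d t)"
  let ?S = "conjugate_on (coord_space Jb) (\<lambda>z. ereal (y * S0 z)) (pb + y *\<^sub>R cb)"
  \<comment> \<open>An \<open>ereal\<close> sum with a summand \<infinity> equals \<infinity>, even
    next to -\<infinity>, so \<open>B < \<infinity>\<close> bounds each summand.\<close>
  have v_fin: "conjugate_on UNIV v y < \<infinity>" and S_fin: "?S < \<infinity>"
    using \<open>B < \<infinity>\<close> unfolding B_def by auto
  have \<sigma>_fin: "?\<sigma> t < \<infinity>" if "t < T" for t
  proof -
    have "(\<Sum>t<T. ?\<sigma> t) \<noteq> \<infinity>" using \<open>B < \<infinity>\<close> unfolding B_def by auto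
    then show ?thesis using that unfolding sum_Pinfty by auto
  qed
  have \<sigma>_ge: "0 \<le> ?\<sigma> t" if "t < T" for t
    using support_fun_upper[OF zero[OF that], of "p t + y *\<^sub>R d t"] by (simp add: zero_ereal_def)
  have S_ge: "0 \<le> ?S"
    using fenchel_young_on[of 0 "coord_space Jb" "pb + y *\<^sub>R cb" "\<lambda>z. ereal (y * S0 z)"] \<open>S0 0 = 0\<close>
    by (simp add: coord_space_def zero_ereal_def)
  have v_ge: "ereal (w * y) - v w \<le> conjugate_on UNIV v y"
    using fenchel_young_on[of w UNIV y v] by simp
  obtain a where a: "v w = ereal a"
    using v_ge v_fin \<open>v w < \<infinity>\<close> by (cases "v w") auto
  obtain bv where bv: "conjugate_on UNIV v y = ereal bv"
    using v_ge v_fin unfolding a by (cases "conjugate_on UNIV v y") auto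
  obtain bs where bs: "?S = ereal bs"
    using S_ge S_fin by (cases ?S) auto
  define bd where "bd t = real_of_ereal (?\<sigma> t)" for t
  have bd: "?\<sigma> t = ereal (bd t)" if "t < T" for t
    unfolding bd_def using \<sigma>_ge[OF that] \<sigma>_fin[OF that] by (cases "?\<sigma> t") auto
  define b where "b = bv + (\<Sum>t<T. bd t) + bs"
  have B: "B = ereal b"
  proof -
    have "(\<Sum>t<T. ?\<sigma> t) = (\<Sum>t<T. ereal (bd t))" using bd by (intro sum.cong) auto
    then show ?thesis unfolding B_def b_def bv bs by simp
  qed
  define gv where "gv = a + bv - w * y"
  define gd where "gd t = bd t - x t \<bullet> (p t + y *\<^sub>R d t)" for t
  define gs where "gs = y * S0 xb + bs - xb \<bullet> (pb + y *\<^sub>R cb)"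
  have gv: "0 \<le> gv" using v_ge unfolding gv_def a bv by simp
  have gd: "0 \<le> gd t" if "t < T" for t
    using support_fun_upper[OF x[OF that], of "p t + y *\<^sub>R d t"] bd[OF that] unfolding gd_def by simp
  have gs: "0 \<le> gs"
    using fenchel_young_on[OF xb, of "pb + y *\<^sub>R cb" "\<lambda>z. ereal (y * S0 z)"] unfolding bs gs_def by simp
  have sum_x: "(\<Sum>t<T. gd t) = (\<Sum>t<T. bd t) - (\<Sum>t<T. x t \<bullet> p t) - y * (\<Sum>t<T. x t \<bullet> d t)"
    unfolding gd_def by (simp add: inner_add_right sum_subtractf sum.distrib sum_distrib_left)
  have "xb \<bullet> (pb + y *\<^sub>R cb) = xb \<bullet> pb + y * (cb \<bullet> xb)"
    by (simp add: inner_add_right inner_commute)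
  \<comment> \<open>Expanding \<open>w * y\<close> in \<open>gv\<close> produces the trading gains,
    the static payoff and the cost \<open>S0 xb\<close>, each times \<open>y\<close>; they cancel
    against \<open>gd\<close> and \<open>gs\<close>.\<close>
  then have gap: "a + b = c * y + ((\<Sum>t<T. x t \<bullet> p t) + xb \<bullet> pb) + (gv + (\<Sum>t<T. gd t) + gs)"
    unfolding sum_x unfolding gv_def gs_def b_def w_def by (simp only: algebra_simps)
  have sum_gd: "0 \<le> (\<Sum>t<T. gd t)" using gd by (intro sum_nonneg) auto
  have "gv = 0 \<longleftrightarrow> y \<in> subdifferential_on UNIV v w"
    using subdifferential_on_iff_fenchel_equality[OF UNIV_I UNIV_I a bv] unfolding gv_def by auto
  moreover have "gs = 0 \<longleftrightarrow> pb + y *\<^sub>R cb \<in> subdifferential_on (coord_space Jb) (\<lambda>z. ereal (y * S0 z)) xb"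
    using subdifferential_on_iff_fenchel_equality[OF xb pb refl bs] unfolding gs_def by auto
  moreover have "(\<Sum>t<T. gd t) = 0 \<longleftrightarrow> (\<forall>t<T. p t + y *\<^sub>R d t \<in> normal_cone_on (coord_space J) (D t) (x t))"
  proof -
    have "(\<Sum>t<T. gd t) = 0 \<longleftrightarrow> (\<forall>t<T. gd t = 0)"
      using gd by (subst sum_nonneg_eq_0_iff) auto
    also have "\<dots> \<longleftrightarrow> (\<forall>t<T. p t + y *\<^sub>R d t \<in> normal_cone_on (coord_space J) (D t) (x t))"
      using normal_cone_on_iff_support_fun_eq[OF x pd bd] unfolding gd_def by auto
    finally show ?thesis .
  qed
  moreover have "gv + (\<Sum>t<T. gd t) + gs = 0 \<longleftrightarrow> gv = 0 \<and> (\<Sum>t<T. gd t) = 0 \<and> gs = 0"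
    using gv gs sum_gd by linarith
  moreover have "a + b = c * y + ((\<Sum>t<T. x t \<bullet> p t) + xb \<bullet> pb) \<longleftrightarrow> gv + (\<Sum>t<T. gd t) + gs = 0"
    using gap by linarith
  moreover have "c * y + ((\<Sum>t<T. x t \<bullet> p t) + xb \<bullet> pb) \<le> a + b"
    using gap gv gs sum_gd by linarith
  ultimately show thesis
    by (intro that[OF a B]) blast+
qed

section \<open>The hedging problem: weak duality and optimality\<close>

lemma scalar_rv_measurable:
  assumes "scalar_rv u \<in> L" and "linear_space_rv M UNIV L"
  shows "u \<in> borel_measurable M"
proof -
  have "scalar_rv u \<in> L0 M UNIV" using assms unfolding linear_space_rv_def by blast
  then show ?thesis unfolding L0_def scalar_rv_def by simp
qed

lemma L0_component_measurable:
  assumes "u \<in> L0 M I"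
  shows "(\<lambda>\<omega>. u \<omega> i) \<in> borel_measurable M"
proof (cases "i \<in> I")
  case True
  then show ?thesis using assms unfolding L0_def by simp
next
  case False
  have "(\<lambda>\<omega>. u \<omega> i) \<in> borel_measurable M \<longleftrightarrow> (\<lambda>\<omega>. 0 :: real) \<in> borel_measurable M"
    by (rule measurable_cong) (use assms False in \<open>simp add: L0_def\<close>)
  then show ?thesis by simp
qed

lemma coord_space_add_scaled:
  "x \<in> coord_space K \<Longrightarrow> z \<in> coord_space K \<Longrightarrow> x + r *\<^sub>R z \<in> coord_space K"
  unfolding coord_space_def by simp

lemma coord_space_diff: "x \<in> coord_space K \<Longrightarrow> z \<in> coord_space K \<Longrightarrow> x - z \<in> coord_space K"
  unfolding coord_space_def by simp

locale semi_static_hedging = prob_space M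
  for M :: "'a measure" and F :: "nat \<Rightarrow> 'a measure" and T :: nat
    and J :: "'j::finite set" and Jb :: "'jb::finite set"
    and s :: "nat \<Rightarrow> 'a \<Rightarrow> real ^ 'j" and cb :: "'a \<Rightarrow> real ^ 'jb" and S0 :: "real ^ 'jb \<Rightarrow> real"
    and D :: "nat \<Rightarrow> 'a \<Rightarrow> (real ^ 'j) set" and V :: "'a \<Rightarrow> real \<Rightarrow> ereal" and c :: "'a \<Rightarrow> real"
    and XX VV :: "('a \<Rightarrow> 'jb + nat \<times> 'j \<Rightarrow> real) set" and U Y :: "('a \<Rightarrow> real) set" +
  assumes filt: "filtration (space M) (\<lambda>t. F (min t T))"
    and subalg: "\<And>t. t \<le> T \<Longrightarrow> subalgebra M (F t)"
    and s_adapted: "\<And>t. t \<le> T \<Longrightarrow> s t \<in> borel_measurable (F t)"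
    and s_coord: "\<And>t \<omega>. t \<le> T \<Longrightarrow> \<omega> \<in> space M \<Longrightarrow> s t \<omega> \<in> coord_space J"
    and cb_measurable: "cb \<in> borel_measurable M"
    and cb_coord: "\<And>\<omega>. \<omega> \<in> space M \<Longrightarrow> cb \<omega> \<in> coord_space Jb"
    and S0_convex: "convex_on (coord_space Jb) S0"
    and S0_zero: "S0 0 = 0"
    and D_random: "\<And>t. t < T \<Longrightarrow> random_closed_convex_set (F t) (coord_space J) (D t)"
    and D_zero: "\<And>t. t < T \<Longrightarrow> AE \<omega> in M. 0 \<in> D t \<omega>"
    and V_integrand: "convex_normal_integrand M V"
    and dual_XV: "dual_spaces M (strategy_index T J Jb) XX VV"
    and dual_UY: "dual_spaces M UNIV (scalar_rv ` U) (scalar_rv ` Y)"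
    and c_U: "c \<in> U"
begin

definition dual_integrand :: "('a \<Rightarrow> 'jb + nat \<times> 'j \<Rightarrow> real) \<Rightarrow> ('a \<Rightarrow> real) \<Rightarrow> 'a \<Rightarrow> ereal" where
  "dual_integrand p y \<omega> =
       conjugate_on UNIV (V \<omega>) (y \<omega>)
       + (\<Sum>t<T. support_fun (D t \<omega>) (dynamic_part (p \<omega>) t + y \<omega> *\<^sub>R (s (Suc t) \<omega> - s t \<omega>)))
       + conjugate_on (coord_space Jb) (\<lambda>xb. ereal (y \<omega> * S0 xb)) (static_part (p \<omega>) + y \<omega> *\<^sub>R cb \<omega>)"

definition fenchel_equality ::
  "('a \<Rightarrow> 'jb + nat \<times> 'j \<Rightarrow> real) \<Rightarrow> ('a \<Rightarrow> 'jb + nat \<times> 'j \<Rightarrow> real) \<Rightarrow> ('a \<Rightarrow> real) \<Rightarrow> 'a \<Rightarrow> bool" where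
  "fenchel_equality x p y \<omega> \<longleftrightarrow>
            y \<omega> \<in> subdifferential_on UNIV (V \<omega>) (net_liability T s cb S0 c x \<omega>) \<and>
            (\<forall>t<T. dynamic_part (p \<omega>) t + y \<omega> *\<^sub>R (s (Suc t) \<omega> - s t \<omega>)
                     \<in> normal_cone_on (coord_space J) (D t \<omega>) (dynamic_part (x \<omega>) t)) \<and>
            static_part (p \<omega>) + y \<omega> *\<^sub>R cb \<omega>
              \<in> subdifferential_on (coord_space Jb) (\<lambda>xb. ereal (y \<omega> * S0 xb)) (static_part (x \<omega>))"

lemma s_measurable: "t \<le> T \<Longrightarrow> s t \<in> borel_measurable M"
  using measurable_from_subalg[OF subalg s_adapted] .

lemma D_measurable: "t < T \<Longrightarrow> measurable_set_valued M (D t)"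
  using D_random[of t] subalg[of t]
  unfolding random_closed_convex_set_def measurable_set_valued_def subalgebra_def by auto

lemma c_measurable: "c \<in> borel_measurable M"
  using scalar_rv_measurable[of c "scalar_rv ` U"] c_U dual_UY unfolding dual_spaces_def by blast

lemma y_measurable: "y \<in> Y \<Longrightarrow> y \<in> borel_measurable M"
  using scalar_rv_measurable[of y "scalar_rv ` Y"] dual_UY unfolding dual_spaces_def by blast

lemma cy_integrable:
  assumes "y \<in> Y"
  shows "integrable M (\<lambda>\<omega>. c \<omega> * y \<omega>)"
proof -
  have "\<forall>u\<in>scalar_rv ` U. \<forall>v\<in>scalar_rv ` Y. integrable M (\<lambda>\<omega>. \<Sum>i\<in>UNIV. u \<omega> i * v \<omega> i)"
    using dual_UY unfolding dual_spaces_def separating_duality_def by simp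
  from this[THEN bspec, OF imageI[OF c_U], THEN bspec, OF imageI[OF assms]]
  show ?thesis by (simp add: scalar_rv_def)
qed

lemma parts_measurable:
  assumes "u \<in> L0 M (strategy_index T J Jb)"
  shows "(\<lambda>\<omega>. static_part (u \<omega>)) \<in> borel_measurable M"
    and "(\<lambda>\<omega>. dynamic_part (u \<omega>) t) \<in> borel_measurable M"
  unfolding borel_measurable_vec_iff static_part_def dynamic_part_def vec_lambda_beta
  by (intro allI L0_component_measurable[OF assms])+

lemma parts_coord:
  assumes "u \<in> L0 M (strategy_index T J Jb)" and "\<omega> \<in> space M"
  shows "static_part (u \<omega>) \<in> coord_space Jb"
    and "dynamic_part (u \<omega>) t \<in> coord_space J"
proof -
  have "u \<omega> i = 0" if "i \<notin> strategy_index T J Jb" for i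
    using assms that unfolding L0_def by simp
  then show "static_part (u \<omega>) \<in> coord_space Jb" "dynamic_part (u \<omega>) t \<in> coord_space J"
    unfolding coord_space_def static_part_def dynamic_part_def strategy_index_def by auto
qed

lemma net_liability_measurable:
  assumes x: "x \<in> L0 M (strategy_index T J Jb)"
  shows "net_liability T s cb S0 c x \<in> borel_measurable M"
proof -
  obtain g where g: "continuous_on UNIV g" "\<And>x. x \<in> coord_space Jb \<Longrightarrow> g x = S0 x"
    using convex_on_coord_space_continuous[OF S0_convex] by blast
  have g_meas: "(\<lambda>\<omega>. g (static_part (x \<omega>))) \<in> borel_measurable M"
    using measurable_compose[OF parts_measurable(1)[OF x] borel_measurable_continuous_onI[OF g(1)]] .
  \<comment> \<open>\<open>S0\<close> is arbitrary off \<open>coord_space Jb\<close>, but on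
    \<open>space M\<close> the static part stays in that subspace, so the continuous
    \<open>g\<close> may replace it.\<close>
  have "net_liability T s cb S0 c x \<in> borel_measurable M \<longleftrightarrow>
      (\<lambda>\<omega>. c \<omega> - (\<Sum>t<T. dynamic_part (x \<omega>) t \<bullet> (s (Suc t) \<omega> - s t \<omega>))
         - cb \<omega> \<bullet> static_part (x \<omega>) + g (static_part (x \<omega>))) \<in> borel_measurable M"
    by (rule measurable_cong) (simp add: net_liability_def g(2) parts_coord(1)[OF x])
  moreover have "(\<lambda>\<omega>. c \<omega> - (\<Sum>t<T. dynamic_part (x \<omega>) t \<bullet> (s (Suc t) \<omega> - s t \<omega>))
         - cb \<omega> \<bullet> static_part (x \<omega>) + g (static_part (x \<omega>))) \<in> borel_measurable M"
    by (intro borel_measurable_add borel_measurable_diff borel_measurable_sum borel_measurable_inner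
        c_measurable cb_measurable parts_measurable[OF x] g_meas s_measurable) auto
  ultimately show ?thesis by blast
qed

lemma dual_integrand_measurable:
  assumes p: "p \<in> L0 M (strategy_index T J Jb)" and y: "y \<in> Y"
  shows "dual_integrand p y \<in> borel_measurable M"
  unfolding dual_integrand_def[abs_def]
  by (intro borel_measurable_ereal_add borel_measurable_ereal_sum borel_measurable_support_fun
      borel_measurable_conjugate_integrand borel_measurable_conjugate_scaled borel_measurable_add
      borel_measurable_scaleR borel_measurable_diff
      V_integrand D_measurable S0_convex parts_measurable[OF p] y_measurable[OF y] cb_measurable s_measurable) auto

text \<open>Each feasibility condition makes one positive part integrable. Once the pairing of
  \<open>x\<close> and \<open>p\<close> is integrable too, the Fenchel inequality controls the
  negative part of either integrand by the positive part of the other. Both objectives are therefore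
  real and can be subtracted.\<close>

lemma weak_duality:
  assumes primal: "SSH_feasible M F T J Jb s cb S0 D V c x"
    and dual: "DSSH_feasible M F T J Jb s cb S0 D V c XX VV Y p y"
  obtains \<alpha> \<beta> where "SSH_objective M T s cb S0 V c x = ereal \<alpha>"
    and "DSSH_objective M T Jb s cb S0 D V c p y = ereal \<beta>"
    and "\<beta> \<le> \<alpha>"
    and "\<alpha> = \<beta> \<longleftrightarrow> (AE \<omega> in M. fenchel_equality x p y \<omega>)"
proof -
  let ?w = "net_liability T s cb S0 c x"
  let ?V = "\<lambda>\<omega>. V \<omega> (?w \<omega>)"
  let ?B = "dual_integrand p y"
  let ?I = "strategy_index T J Jb"
  define g where "g \<omega> = (\<Sum>i\<in>?I. x \<omega> i * p \<omega> i)" for \<omega>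
  have x: "x \<in> adapted_strategies M F T J Jb" and xD: "\<And>t. t < T \<Longrightarrow> AE \<omega> in M. dynamic_part (x \<omega>) t \<in> D t \<omega>"
    using primal unfolding SSH_feasible_def SSH_constraint_set_def by auto
  then have xL: "x \<in> L0 M ?I" unfolding adapted_strategies_def by simp
  have p: "p \<in> adapted_annihilator M F T J Jb XX VV" and y: "y \<in> Y"
    using dual unfolding DSSH_feasible_def by auto
  have pL: "p \<in> L0 M ?I"
    using p dual_XV unfolding adapted_annihilator_def dual_spaces_def linear_space_rv_def by blast
  have V_meas: "?V \<in> borel_measurable M"
    by (rule borel_measurable_integrand[OF V_integrand net_liability_measurable[OF xL]])
  have B_meas: "?B \<in> borel_measurable M"
    by (rule dual_integrand_measurable[OF pL y])
  have obj: "SSH_objective M T s cb S0 V c x = ext_expectation M ?V"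
    unfolding SSH_objective_def ..
  have dobj: "DSSH_objective M T Jb s cb S0 D V c p y = ereal (\<integral>\<omega>. c \<omega> * y \<omega> \<partial>M) - ext_expectation M ?B"
    unfolding DSSH_objective_def dual_integrand_def[abs_def] ..
  have "ext_expectation M ?V < \<infinity>"
    using primal unfolding SSH_feasible_def obj by simp
  note V_fin = ext_expectation_less_infinityD[OF V_meas this]
  \<comment> \<open>An infinite expectation here would make the dual objective -\<infinity>.\<close>
  have "ext_expectation M ?B < \<infinity>"
    using dual unfolding DSSH_feasible_def dobj by (cases "ext_expectation M ?B") auto
  note B_fin = ext_expectation_less_infinityD[OF B_meas this]
  define a where "a \<omega> = real_of_ereal (?V \<omega>)" for \<omega>
  define b where "b \<omega> = real_of_ereal (?B \<omega>)" for \<omega>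
  have a_meas: "a \<in> borel_measurable M"
    unfolding a_def[abs_def] by (rule borel_measurable_real_of_ereal[OF V_meas])
  have b_meas: "b \<in> borel_measurable M"
    unfolding b_def[abs_def] by (rule borel_measurable_real_of_ereal[OF B_meas])
  have xD': "AE \<omega> in M. \<forall>t\<in>{..<T}. dynamic_part (x \<omega>) t \<in> D t \<omega> \<and> 0 \<in> D t \<omega>"
  proof (rule AE_finite_allI)
    fix t assume "t \<in> {..<T}"
    then show "AE \<omega> in M. dynamic_part (x \<omega>) t \<in> D t \<omega> \<and> 0 \<in> D t \<omega>"
      using xD[of t] D_zero[of t] by simp
  qed simp
  have gap: "AE \<omega> in M. ?V \<omega> = ereal (a \<omega>) \<and> ?B \<omega> = ereal (b \<omega>) \<and> c \<omega> * y \<omega> + g \<omega> \<le> a \<omega> + b \<omega> \<and>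
      (a \<omega> + b \<omega> = c \<omega> * y \<omega> + g \<omega> \<longleftrightarrow> fenchel_equality x p y \<omega>)"
    using AE_space xD' V_fin(1) B_fin(1)
  proof eventually_elim
    case (elim \<omega>)
    have g: "g \<omega> = (\<Sum>t<T. dynamic_part (x \<omega>) t \<bullet> dynamic_part (p \<omega>) t) + static_part (x \<omega>) \<bullet> static_part (p \<omega>)"
      unfolding g_def by (rule sum_strategy_index) (use xL elim(1) in \<open>simp add: L0_def\<close>)
    have pd: "dynamic_part (p \<omega>) t + y \<omega> *\<^sub>R (s (Suc t) \<omega> - s t \<omega>) \<in> coord_space J" if "t < T" for t
      by (intro coord_space_add_scaled coord_space_diff parts_coord[OF pL] s_coord) (use that elim(1) in auto)
    have pb: "static_part (p \<omega>) + y \<omega> *\<^sub>R cb \<omega> \<in> coord_space Jb"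
      by (intro coord_space_add_scaled parts_coord[OF pL] cb_coord elim(1))
    have D: "0 \<in> D t \<omega>" "dynamic_part (x \<omega>) t \<in> D t \<omega>" if "t < T" for t
      using elim(2) that by auto
    obtain a' b' where ab: "?V \<omega> = ereal a'" "?B \<omega> = ereal b'"
      "c \<omega> * y \<omega> + g \<omega> \<le> a' + b'" "a' + b' = c \<omega> * y \<omega> + g \<omega> \<longleftrightarrow> fenchel_equality x p y \<omega>"
      using pointwise_fenchel_gap[where v = "V \<omega>" and D = "\<lambda>t. D t \<omega>" and x = "dynamic_part (x \<omega>)"
          and p = "dynamic_part (p \<omega>)" and d = "\<lambda>t. s (Suc t) \<omega> - s t \<omega>" and xb = "static_part (x \<omega>)"
          and pb = "static_part (p \<omega>)" and cb = "cb \<omega>" and y = "y \<omega>" and c = "c \<omega>" and T = T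
          and J = J and Jb = Jb and ?S0.0 = S0,
          OF S0_zero D parts_coord(1)[OF xL elim(1)] pd pb
          elim(3)[unfolded net_liability_def] elim(4)[unfolded dual_integrand_def]]
      unfolding g fenchel_equality_def net_liability_def dual_integrand_def by blast
    then show ?case unfolding a_def b_def by simp
  qed
  \<comment> \<open>Solve the Fenchel inequality for \<open>g\<close> and drop the negative parts of
    \<open>a\<close> and \<open>b\<close>.\<close>
  define \<phi> where "\<phi> \<omega> = max 0 (a \<omega>) + max 0 (b \<omega>) - c \<omega> * y \<omega>" for \<omega>
  have ap: "integrable M (\<lambda>\<omega>. max 0 (a \<omega>))" and bp: "integrable M (\<lambda>\<omega>. max 0 (b \<omega>))"
    using V_fin(2) B_fin(2) unfolding a_def b_def by auto
  note cy = cy_integrable[OF y]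
  have phi: "integrable M \<phi>"
    unfolding \<phi>_def[abs_def] by (intro Bochner_Integration.integrable_diff Bochner_Integration.integrable_add ap bp cy)
  have "AE \<omega> in M. g \<omega> \<le> \<phi> \<omega>"
    using gap by eventually_elim (auto simp: \<phi>_def)
  then have g_int: "integrable M g" and g_zero: "(\<integral>\<omega>. g \<omega> \<partial>M) = 0"
    using adapted_annihilator_pairing_zero[OF prob_space_axioms filt subalg dual_XV x p phi] unfolding g_def by auto
  have a_int: "integrable M a"
  proof (rule Bochner_Integration.integrable_bound)
    \<comment> \<open>The Fenchel inequality bounds \<open>a\<close> from below by
      \<open>c \<omega> * y \<omega> + g \<omega> - max 0 (b \<omega>)\<close>, whose modulus
      therefore dominates the negative part of \<open>a\<close>.\<close>
    show "integrable M (\<lambda>\<omega>. max 0 (a \<omega>) + \<bar>c \<omega> * y \<omega> + g \<omega> - max 0 (b \<omega>)\<bar>)"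
      by (intro Bochner_Integration.integrable_add integrable_abs Bochner_Integration.integrable_diff ap bp cy g_int)
    show "AE \<omega> in M. norm (a \<omega>) \<le> norm (max 0 (a \<omega>) + \<bar>c \<omega> * y \<omega> + g \<omega> - max 0 (b \<omega>)\<bar>)"
      using gap by eventually_elim (auto simp: max_def abs_if)
  qed (rule a_meas)
  have b_int: "integrable M b"
  proof (rule Bochner_Integration.integrable_bound)
    show "integrable M (\<lambda>\<omega>. max 0 (b \<omega>) + \<bar>c \<omega> * y \<omega> + g \<omega> - max 0 (a \<omega>)\<bar>)"
      by (intro Bochner_Integration.integrable_add integrable_abs Bochner_Integration.integrable_diff ap bp cy g_int)
    show "AE \<omega> in M. norm (b \<omega>) \<le> norm (max 0 (b \<omega>) + \<bar>c \<omega> * y \<omega> + g \<omega> - max 0 (a \<omega>)\<bar>)"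
      using gap by eventually_elim (auto simp: max_def abs_if)
  qed (rule b_meas)
  define h where "h \<omega> = a \<omega> + b \<omega> - (c \<omega> * y \<omega> + g \<omega>)" for \<omega>
  have h_int: "integrable M h"
    unfolding h_def[abs_def] by (intro Bochner_Integration.integrable_add Bochner_Integration.integrable_diff a_int b_int cy g_int)
  have h_nn: "AE \<omega> in M. 0 \<le> h \<omega>"
    using gap by eventually_elim (simp add: h_def)
  have h_eq: "(\<integral>\<omega>. h \<omega> \<partial>M) = (\<integral>\<omega>. a \<omega> \<partial>M) - ((\<integral>\<omega>. c \<omega> * y \<omega> \<partial>M) - (\<integral>\<omega>. b \<omega> \<partial>M))"
    unfolding h_def using a_int b_int cy g_int g_zero by simp
  have EV: "ext_expectation M ?V = ereal (\<integral>\<omega>. a \<omega> \<partial>M)"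
    by (rule ext_expectation_eq_integral[OF _ a_int]) (use gap in auto)
  have EB: "ext_expectation M ?B = ereal (\<integral>\<omega>. b \<omega> \<partial>M)"
    by (rule ext_expectation_eq_integral[OF _ b_int]) (use gap in auto)
  show thesis
  proof
    show "SSH_objective M T s cb S0 V c x = ereal (\<integral>\<omega>. a \<omega> \<partial>M)"
      unfolding obj EV ..
    show "DSSH_objective M T Jb s cb S0 D V c p y = ereal ((\<integral>\<omega>. c \<omega> * y \<omega> \<partial>M) - (\<integral>\<omega>. b \<omega> \<partial>M))"
      unfolding dobj EB by simp
    show "(\<integral>\<omega>. c \<omega> * y \<omega> \<partial>M) - (\<integral>\<omega>. b \<omega> \<partial>M) \<le> (\<integral>\<omega>. a \<omega> \<partial>M)"
      using integral_nonneg_AE[OF h_nn] unfolding h_eq by simp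
    have "(\<integral>\<omega>. a \<omega> \<partial>M) = (\<integral>\<omega>. c \<omega> * y \<omega> \<partial>M) - (\<integral>\<omega>. b \<omega> \<partial>M) \<longleftrightarrow> (\<integral>\<omega>. h \<omega> \<partial>M) = 0"
      unfolding h_eq by simp
    also have "\<dots> \<longleftrightarrow> (AE \<omega> in M. h \<omega> = 0)"
      by (rule integral_nonneg_eq_0_iff_AE[OF h_int h_nn])
    also have "\<dots> \<longleftrightarrow> (AE \<omega> in M. fenchel_equality x p y \<omega>)"
    proof (rule eventually_subst)
      show "AE \<omega> in M. (h \<omega> = 0) = fenchel_equality x p y \<omega>"
        using gap by eventually_elim (auto simp: h_def)
    qed
    finally show "(\<integral>\<omega>. a \<omega> \<partial>M) = (\<integral>\<omega>. c \<omega> * y \<omega> \<partial>M) - (\<integral>\<omega>. b \<omega> \<partial>M) \<longleftrightarrow>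
        (AE \<omega> in M. fenchel_equality x p y \<omega>)" .
  qed
qed

text \<open>The infimum runs over the constraint set, which may contain points of infinite
  objective; these are harmless, and the others are feasible.\<close>

lemma SSH_value_ge:
  assumes dual: "DSSH_feasible M F T J Jb s cb S0 D V c XX VV Y p y"
  shows "DSSH_objective M T Jb s cb S0 D V c p y \<le> SSH_value M F T J Jb s cb S0 D V c"
  unfolding SSH_value_def
proof (rule INF_greatest)
  fix x assume x: "x \<in> SSH_constraint_set M F T J Jb D"
  show "DSSH_objective M T Jb s cb S0 D V c p y \<le> SSH_objective M T s cb S0 V c x"
  proof (cases "SSH_objective M T s cb S0 V c x < \<infinity>")
    case True
    with x have "SSH_feasible M F T J Jb s cb S0 D V c x" unfolding SSH_feasible_def by simp
    from weak_duality[OF this dual] show ?thesis by (metis ereal_less_eq(3))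
  qed simp
qed

lemma DSSH_value_le:
  assumes primal: "SSH_feasible M F T J Jb s cb S0 D V c x"
  shows "DSSH_value M F T J Jb s cb S0 D V c XX VV Y \<le> SSH_objective M T s cb S0 V c x"
  unfolding DSSH_value_def
proof (rule SUP_least, clarify)
  fix p y assume py: "p \<in> adapted_annihilator M F T J Jb XX VV" "y \<in> Y"
  show "DSSH_objective M T Jb s cb S0 D V c p y \<le> SSH_objective M T s cb S0 V c x"
  proof (cases "DSSH_objective M T Jb s cb S0 D V c p y > - \<infinity>")
    case True
    with py have "DSSH_feasible M F T J Jb s cb S0 D V c XX VV Y p y" unfolding DSSH_feasible_def by simp
    from weak_duality[OF primal this] show ?thesis by (metis ereal_less_eq(3))
  qed simp
qed

lemma optimality_iff_fenchel_equality:
  "SSH_solves M F T J Jb s cb S0 D V c x \<and>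
    DSSH_solves M F T J Jb s cb S0 D V c XX VV Y p y \<and>
    SSH_value M F T J Jb s cb S0 D V c = DSSH_value M F T J Jb s cb S0 D V c XX VV Y
   \<longleftrightarrow>
    SSH_feasible M F T J Jb s cb S0 D V c x \<and>
    DSSH_feasible M F T J Jb s cb S0 D V c XX VV Y p y \<and>
    (AE \<omega> in M. fenchel_equality x p y \<omega>)" (is "?opt \<longleftrightarrow> ?P \<and> ?Q \<and> ?E")
proof (cases "?P \<and> ?Q")
  case True
  then have P: ?P and Q: ?Q by auto
  let ?f = "SSH_objective M T s cb S0 V c x" and ?g = "DSSH_objective M T Jb s cb S0 D V c p y"
  let ?vP = "SSH_value M F T J Jb s cb S0 D V c" and ?vD = "DSSH_value M F T J Jb s cb S0 D V c XX VV Y"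
  have eq: "?f = ?g \<longleftrightarrow> ?E"
    by (rule weak_duality[OF P Q]) simp
  have "?vP \<le> ?f"
    unfolding SSH_value_def using P by (intro INF_lower) (simp add: SSH_feasible_def)
  moreover have "?g \<le> ?vD"
  proof -
    have "(p, y) \<in> adapted_annihilator M F T J Jb XX VV \<times> Y"
      using Q unfolding DSSH_feasible_def by simp
    from SUP_upper[OF this, of "\<lambda>(p, y). DSSH_objective M T Jb s cb S0 D V c p y"]
    show ?thesis unfolding DSSH_value_def by simp
  qed
  moreover note SSH_value_ge[OF Q] DSSH_value_le[OF P]
  \<comment> \<open>Both optimal values lie between \<open>?g\<close> and \<open>?f\<close>, so
    \<open>?f = ?g\<close> makes all four equal.\<close>
  ultimately have "?f = ?vP \<and> ?g = ?vD \<and> ?vP = ?vD \<longleftrightarrow> ?f = ?g"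
    by auto
  then show ?thesis
    unfolding SSH_solves_def DSSH_solves_def using P Q eq by blast
next
  \<comment> \<open>Feasibility of both points is part of either side.\<close>
  case False
  then show ?thesis unfolding SSH_solves_def DSSH_solves_def by blast
qed

end

theorem theorem56:
  fixes M :: "'a measure"
    and F :: "nat \<Rightarrow> 'a measure"
    and T :: nat
    and J :: "'j::finite set"
    and Jb :: "'jb::finite set"
    and s :: "nat \<Rightarrow> 'a \<Rightarrow> real ^ 'j"
    and cb :: "'a \<Rightarrow> real ^ 'jb"
    and S0 :: "real ^ 'jb \<Rightarrow> real"
    and D :: "nat \<Rightarrow> 'a \<Rightarrow> (real ^ 'j) set"
    and V :: "'a \<Rightarrow> real \<Rightarrow> ereal"
    and c :: "'a \<Rightarrow> real"
    and XX VV :: "('a \<Rightarrow> 'jb + nat \<times> 'j \<Rightarrow> real) set"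
    and U Y :: "('a \<Rightarrow> real) set"
    and x p :: "'a \<Rightarrow> 'jb + nat \<times> 'j \<Rightarrow> real"
    and y :: "'a \<Rightarrow> real"
  assumes "prob_space M"
    and "filtration (space M) (\<lambda>t. F (min t T))"
    and "\<And>t. t \<le> T \<Longrightarrow> subalgebra M (F t)"
    and "\<And>t. t \<le> T \<Longrightarrow> s t \<in> borel_measurable (F t)"
    and "\<And>t \<omega>. t \<le> T \<Longrightarrow> \<omega> \<in> space M \<Longrightarrow> s t \<omega> \<in> coord_space J"
    and "cb \<in> borel_measurable M"
    and "\<And>\<omega>. \<omega> \<in> space M \<Longrightarrow> cb \<omega> \<in> coord_space Jb"
    and "convex_on (coord_space Jb) S0"
    and "S0 0 = 0"
    and "\<And>t. t < T \<Longrightarrow> random_closed_convex_set (F t) (coord_space J) (D t)"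
    and "\<And>t. t < T \<Longrightarrow> AE \<omega> in M. 0 \<in> D t \<omega>"
    and "loss_function M V"
    and "dual_spaces M (strategy_index T J Jb) XX VV"
    and "dual_spaces M UNIV (scalar_rv ` U) (scalar_rv ` Y)"
    and "c \<in> U"
    and "EV_proper_on M V U"
    and "\<exists>x'. SSH_feasible M F T J Jb s cb S0 D V c x'"
    and "\<exists>p' y'. DSSH_feasible M F T J Jb s cb S0 D V c XX VV Y p' y'"
  shows "SSH_solves M F T J Jb s cb S0 D V c x \<and>
         DSSH_solves M F T J Jb s cb S0 D V c XX VV Y p y \<and>
         SSH_value M F T J Jb s cb S0 D V c = DSSH_value M F T J Jb s cb S0 D V c XX VV Y
     \<longleftrightarrow>
         SSH_feasible M F T J Jb s cb S0 D V c x \<and>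
         DSSH_feasible M F T J Jb s cb S0 D V c XX VV Y p y \<and>
         (AE \<omega> in M.
            y \<omega> \<in> subdifferential_on UNIV (V \<omega>) (net_liability T s cb S0 c x \<omega>) \<and>
            (\<forall>t<T. dynamic_part (p \<omega>) t + y \<omega> *\<^sub>R (s (Suc t) \<omega> - s t \<omega>)
                     \<in> normal_cone_on (coord_space J) (D t \<omega>) (dynamic_part (x \<omega>) t)) \<and>
            static_part (p \<omega>) + y \<omega> *\<^sub>R cb \<omega>
              \<in> subdifferential_on (coord_space Jb) (\<lambda>xb. ereal (y \<omega> * S0 xb)) (static_part (x \<omega>)))"
proof -
  have "convex_normal_integrand M V"
    using assms(12) unfolding loss_function_def by simp
  then interpret semi_static_hedging M F T J Jb s cb S0 D V c XX VV U Y
    by (intro semi_static_hedging.intro semi_static_hedging_axioms.intro assms)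
  show ?thesis
    using optimality_iff_fenchel_equality[of x p y] unfolding fenchel_equality_def .
qed

end
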